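(* Let $\mathbb{F}$ be a field of characteristic different from $2$. Let $V$ be an $n$-dimensional vector space over $\mathbb{F}$ equipped with a symplectic form $b$, and let $\mathcal{V}$ be a nilpotent linear subspace of $\mathcal{S}_b$. Set $\nu:=\frac{n}{2}$ and assume that $|\mathbb{F}| \geq n$ and $\dim \mathcal{V}=\nu(n-\nu)$. Then $\mathcal{V}=\mathcal{NS}_{b,\mathcal{F}}$ for some maximal partially complete $b$-singular flag $\mathcal{F}$ of $V$.
   Context: A symplectic form is a non-degenerate alternating bilinear form. An endomorphism $u$ of $V$ is $b$-symmetric when the bilinear form $(x,y) \mapsto b(x,u(y))$ is symmetric; $\mathcal{S}_b$ denotes the linear space of all $b$-symmetric endomorphisms of $V$. A set of endomorphisms is nilpotent when all its elements are nilpotent. A linear subspace $X$ of $V$ is totally singular for $b$ if $b(x,y)=0$ for all $x,y \in X$; the Witt index of $b$ is the maximal dimension of a totally singular subspace (for a symplectic form it equals $n/2$). A flag $\mathcal{F}=(F_0,\dots,F_p)$ of $V$ is a finite increasing sequence of linear subspaces of $V$; it is partially complete if $\dim F_i=i$ for all $i\in\{0,\dots,p\}$; it is $b$-singular if $F_p$ is totally singular for $b$; a partially complete $b$-singular flag is maximal if $p$ equals the Witt index of $b$. An endomorphism $u$ stabilizes $\mathcal{F}$ if $u(F_i)\subset F_i$ for all $i$. For a maximal partially complete $b$-singular flag $\mathcal{F}$, $\mathcal{NS}_{b,\mathcal{F}}$ denotes the set of all nilpotent $u \in \mathcal{S}_b$ that stabilize $\mathcal{F}$. *)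

theory Defs
  imports Complex_Main "HOL-Library.Function_Algebras"
begin

definition nilpotent :: "('b::zero \<Rightarrow> 'b) \<Rightarrow> bool" where
  "nilpotent u \<longleftrightarrow> (\<exists>k. \<forall>x. (u ^^ k) x = 0)"

text \<open>Pointwise scalar multiplication; the pointwise addition of functions comes from
  \<^theory>\<open>HOL-Library.Function_Algebras\<close>.  Linear spaces of endomorphisms, and their
  dimensions, are taken inside the vector space of all functions.\<close>

definition fun_scale :: "('a \<Rightarrow> 'b \<Rightarrow> 'b) \<Rightarrow> 'a \<Rightarrow> ('b \<Rightarrow> 'b) \<Rightarrow> 'b \<Rightarrow> 'b" where
  "fun_scale scale c u = (\<lambda>x. scale c (u x))"

lemma vector_space_fun_scale:
  assumes "vector_space scale"
  shows "vector_space (fun_scale scale)"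
proof -
  interpret vector_space scale by fact
  show ?thesis
    by unfold_locales (auto simp: fun_scale_def fun_eq_iff algebra_simps)
qed

locale bilinear_space = vector_space scale
  for scale :: "'a::field \<Rightarrow> 'b::ab_group_add \<Rightarrow> 'b" +
  fixes b :: "'b \<Rightarrow> 'b \<Rightarrow> 'a"
  assumes linear_right: "Vector_Spaces.linear scale (*) (\<lambda>y. b x y)"
    and linear_left: "Vector_Spaces.linear scale (*) (\<lambda>x. b x y)"
begin

definition symmetric_endos :: "('b \<Rightarrow> 'b) set" where
  "symmetric_endos =
     {u. Vector_Spaces.linear scale scale u \<and> (\<forall>x y. b x (u y) = b y (u x))}"

definition totally_singular :: "'b set \<Rightarrow> bool" where
  "totally_singular X \<longleftrightarrow> subspace X \<and> (\<forall>x\<in>X. \<forall>y\<in>X. b x y = 0)"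

definition witt_index :: nat where
  "witt_index = Max {dim X |X. totally_singular X}"

text \<open>The flag \<open>(F\<^sub>0, \<dots>, F\<^sub>p)\<close> is represented by a list of length \<open>p + 1\<close>.\<close>

definition flag :: "'b set list \<Rightarrow> bool" where
  "flag F \<longleftrightarrow> F \<noteq> [] \<and> (\<forall>X\<in>set F. subspace X) \<and> sorted_wrt (\<subseteq>) F"

definition partially_complete :: "'b set list \<Rightarrow> bool" where
  "partially_complete F \<longleftrightarrow> flag F \<and> (\<forall>i<length F. dim (F ! i) = i)"

definition singular_flag :: "'b set list \<Rightarrow> bool" where
  "singular_flag F \<longleftrightarrow> flag F \<and> totally_singular (last F)"

definition maximal_singular_flag :: "'b set list \<Rightarrow> bool" where
  "maximal_singular_flag F \<longleftrightarrow>
     partially_complete F \<and> singular_flag F \<and> length F = witt_index + 1"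

definition stabilizes :: "('b \<Rightarrow> 'b) \<Rightarrow> 'b set list \<Rightarrow> bool" where
  "stabilizes u F \<longleftrightarrow> (\<forall>X\<in>set F. u ` X \<subseteq> X)"

definition NS :: "'b set list \<Rightarrow> ('b \<Rightarrow> 'b) set" where
  "NS F = {u \<in> symmetric_endos. nilpotent u \<and> stabilizes u F}"

end

text \<open>An alternating bilinear form satisfies \<open>b x y = - b y x\<close>, so its left and right radicals
  coincide and non-degeneracy need only be required on one side.\<close>

locale symplectic_space =
  finite_dimensional_vector_space scale Basis + bilinear_space scale b
  for scale :: "'a::field \<Rightarrow> 'b::ab_group_add \<Rightarrow> 'b"
    and Basis :: "'b set"
    and b :: "'b \<Rightarrow> 'b \<Rightarrow> 'a" +
  assumes alternating: "b x x = 0"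
    and nondegenerate: "(\<And>y. b x y = 0) \<Longrightarrow> x = 0"

end

theory Submission
  imports Defs "HOL-Computational_Algebra.Polynomial"
begin

text \<open>
  Let \<open>V\<close> be the space of maps. For a nonzero \<open>x\<close>, the maps of \<open>V\<close> that kill \<open>x\<close> act on \<open>{x}\<^sup>\<bottom> / x\<close>, and those that act
  trivially there are the maps \<open>x \<otimes> y : z \<mapsto> b(x,z) y + b(y,z) x\<close> with \<open>y \<in> {x}\<^sup>\<bottom>\<close>. The trace form vanishes
  on \<open>V\<close>, so \<open>x \<otimes> y \<in> V\<close> forces \<open>y\<close> to be orthogonal to \<open>N\<^sub>x = \<langle>x\<rangle> + V x\<close>; with \<open>x \<notin> V x\<close>, induction gives
  \<open>dim V \<le> \<nu>\<^sup>2\<close>. In the case of equality, \<open>x \<otimes> y \<in> V\<close> for every \<open>y \<in> N\<^sub>x\<^sup>\<bottom>\<close>, and the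
  space induced on \<open>{x}\<^sup>\<bottom> / x\<close> again has maximal dimension; by induction it contains a regular nilpotent
  element, induced by some \<open>w \<in> V\<close> with \<open>w x = 0\<close>.

  It remains to find \<open>x \<noteq> 0\<close> with \<open>V x = 0\<close>. Among the \<open>x \<noteq> 0\<close> with \<open>b(x, V x) = 0\<close>, which exist
  because a vector in the range of \<open>u\<^sup>p\<^sup>-\<^sup>1\<close> has this property if \<open>u\<close> has the largest nilpotency index \<open>p\<close> in \<open>V\<close>,
  choose one with \<open>dim N\<^sub>x\<close> minimal. Nilpotency of \<open>v + s (x \<otimes> y)\<close> gives \<open>v\<^sup>k x \<in> N\<^sub>x\<close> for all
  \<open>v \<in> V\<close>, and polarising with \<open>w + s v\<close> shows that \<open>N\<^sub>x\<close> is stable under \<open>V\<close>, hence totally singular.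
  If \<open>V x \<noteq> 0\<close>, then \<open>w\<close> has a kernel vector \<open>y\<close> in \<open>N\<^sub>x\<close> outside the line of \<open>x\<close>, and \<open>N\<^sub>y = N\<^sub>x\<close> by
  minimality; this contradicts the nilpotency of the maps \<open>w + s v\<close> on \<open>N\<^sub>x\<close>.

  The quotient \<open>{x}\<^sup>\<bottom> / x\<close> is realised inside the space as the orthogonal complement of a hyperbolic pair
  \<open>x, x'\<close>, so that the induction runs over nondegenerate subspaces \<open>W\<close> of a fixed space and over spaces
  of maps with range in \<open>W\<close>.
\<close>

section \<open>Linear algebra\<close>

lemma funpow_funpow: "(w ^^ m) ((w ^^ n) x) = (w ^^ (m + n)) x"
  by (simp add: funpow_add)

text \<open>The finite spanning set allows applications to spaces of maps, whose ambient space may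
  be infinite-dimensional. A basis of the kernel is extended to \<open>S\<close>, and
  \<open>f\<close> is injective on the span of the added vectors.\<close>

lemma (in vector_space_pair) rank_nullity_on:
  assumes lf: "Vector_Spaces.linear s1 s2 f" and S: "vs1.subspace S"
    and G: "finite G" "S \<subseteq> vs1.span G"
  shows "vs1.dim S = vs2.dim (f ` S) + vs1.dim {x \<in> S. f x = 0}"
proof -
  interpret f: Vector_Spaces.linear s1 s2 f by fact
  let ?K = "{x \<in> S. f x = 0}"
  obtain B where B: "B \<subseteq> ?K" "vs1.independent B" "?K \<subseteq> vs1.span B" "card B = vs1.dim ?K"
    using vs1.basis_exists[of ?K] by blast
  obtain C where C: "B \<subseteq> C" "C \<subseteq> S" "vs1.independent C" "S \<subseteq> vs1.span C"
    using vs1.maximal_independent_subset_extend[of B S] B by blast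
  have finC: "finite C"
    using vs1.independent_span_bound[OF G(1) C(3)] C(2) G(2) by blast
  have dimS: "vs1.dim S = card C" using vs1.basis_card_eq_dim C by metis
  have "vs1.span (C - B) \<subseteq> S"
    using C(2) S by (intro vs1.span_minimal) auto
  have inj: "inj_on f (vs1.span (C - B))"
  proof (subst f.inj_on_iff_eq_0[OF vs1.subspace_span], intro ballI impI)
    fix x assume x: "x \<in> vs1.span (C - B)" "f x = 0"
    then have xB: "x \<in> vs1.span B" using \<open>vs1.span (C - B) \<subseteq> S\<close> B(3) by blast
    have "vs1.representation C x = vs1.representation B x"
      by (rule vs1.representation_extend[OF C(3) xB C(1)])
    moreover have "vs1.representation C x = vs1.representation (C - B) x"
      by (rule vs1.representation_extend[OF C(3) x(1)]) auto
    ultimately have "vs1.representation C x v = 0" for v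
      using vs1.representation_ne_zero[of B x v] vs1.representation_ne_zero[of "C - B" x v]
      by (metis Diff_iff)
    then show "x = 0"
      using vs1.sum_nonzero_representation_eq[OF C(3), of x] xB vs1.span_mono[OF C(1)]
      by (simp add: subset_iff)
  qed
  have "f ` S = vs2.span (f ` (C - B))"
  proof
    have "f ` S \<subseteq> vs2.span (f ` C)" using C(4) by (rule f.spans_image)
    also have "f ` C \<subseteq> vs2.span (f ` (C - B))"
    proof (intro image_subsetI)
      fix v assume "v \<in> C"
      then show "f v \<in> vs2.span (f ` (C - B))"
        using B(1) vs2.span_zero by (cases "v \<in> B") (auto intro: vs2.span_base)
    qed
    then have "vs2.span (f ` C) \<subseteq> vs2.span (f ` (C - B))"
      by (intro vs2.span_minimal) auto
    finally show "f ` S \<subseteq> vs2.span (f ` (C - B))" .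
    show "vs2.span (f ` (C - B)) \<subseteq> f ` S"
      using C(2) f.subspace_image[OF S] by (intro vs2.span_minimal) auto
  qed
  moreover have "vs2.independent (f ` (C - B))"
    by (rule f.independent_injective_image[OF vs1.independent_mono[OF C(3) Diff_subset] inj])
  ultimately have "vs2.dim (f ` S) = card (f ` (C - B))"
    using vs2.dim_span_eq_card_independent by simp
  also have "\<dots> = card (C - B)"
    using inj vs1.span_superset by (intro card_image) (rule inj_on_subset)
  finally show ?thesis
    using dimS B(4) card_mono[OF finC C(1)] by (simp add: card_Diff_subset finite_subset[OF C(1) finC] C(1))
qed

text \<open>A nonzero polynomial of degree below \<open>r\<close> has fewer than \<open>r\<close>
  roots. The size of the field enters the whole proof through this lemma; \<open>card\<close> of an
  infinite type is 0, whence the disjunction.\<close>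

lemma vanishing_polynomial_coeffs:
  fixes c :: "nat \<Rightarrow> 'a::field"
  assumes F: "infinite (UNIV :: 'a set) \<or> r \<le> card (UNIV :: 'a set)"
    and 0: "\<And>s. (\<Sum>i<r. s ^ i * c i) = 0" and i: "i < r"
  shows "c i = 0"
proof (rule ccontr)
  assume nz: "c i \<noteq> 0"
  define p where "p = (\<Sum>i<r. monom (c i) i)"
  have cp: "coeff p j = (if j < r then c j else 0)" for j
    by (auto simp: p_def coeff_sum if_distrib cong: if_cong)
  have "p \<noteq> 0" using nz cp[of i] i by auto
  have "poly p s = 0" for s
    using 0[of s] by (simp add: p_def poly_sum poly_monom mult.commute)
  then have "{x. poly p x = 0} = UNIV" by auto
  moreover have "degree p < r"
    using i cp by (metis \<open>p \<noteq> 0\<close> leading_coeff_0_iff)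
  ultimately show False
    using F \<open>p \<noteq> 0\<close> card_poly_roots_bound[OF \<open>p \<noteq> 0\<close>] poly_roots_finite[OF \<open>p \<noteq> 0\<close>] by auto
qed

context finite_dimensional_vector_space
begin

section \<open>Strings of a linear map modulo a stable subspace\<close>

lemma linear_funpow:
  "Vector_Spaces.linear scale scale w \<Longrightarrow> Vector_Spaces.linear scale scale (w ^^ k)"
proof (induct k)
  case (Suc k)
  then show ?case
    using Vector_Spaces.linear_compose[of scale scale "w ^^ k" scale w] by (simp add: o_def)
qed (use linear_id in simp)

text \<open>Applying \<open>w ^^ (k - j)\<close> sends the whole span into \<open>K\<close>, but
  \<open>(w ^^ j) e\<close> to \<open>(w ^^ k) e\<close>.\<close>

lemma string_notin_span:
  assumes w: "Vector_Spaces.linear scale scale w" and K: "subspace K" "\<And>z. z \<in> K \<Longrightarrow> w z \<in> K"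
    and k: "(w ^^ k) e \<notin> K" "\<And>i. i > k \<Longrightarrow> (w ^^ i) e \<in> K" and j: "j \<le> k"
  shows "(w ^^ j) e \<notin> span (K \<union> (\<lambda>i. (w ^^ i) e) ` {Suc j..k})"
proof
  interpret wi: Vector_Spaces.linear scale scale "w ^^ (k - j)" by (rule linear_funpow[OF w])
  have Kp: "z \<in> K \<Longrightarrow> (w ^^ i) z \<in> K" for i z by (induct i) (auto intro: K)
  assume "(w ^^ j) e \<in> span (K \<union> (\<lambda>i. (w ^^ i) e) ` {Suc j..k})"
  moreover have "K \<union> (\<lambda>i. (w ^^ i) e) ` {Suc j..k} \<subseteq> {z. (w ^^ (k - j)) z \<in> K}"
  proof -
    have "(w ^^ (k - j)) ((w ^^ i) e) \<in> K" if "j < i" for i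
      using k(2)[of "k - j + i"] that j unfolding funpow_funpow by linarith
    then show ?thesis using Kp by auto
  qed
  ultimately have "(w ^^ (k - j)) ((w ^^ j) e) \<in> K"
    using span_minimal[OF _ wi.subspace_linear_preimage[OF K(1)]] by blast
  then have "(w ^^ (k - j + j)) e \<in> K" by (simp only: funpow_add o_def)
  then show False using k(1) j by simp
qed

lemma string_dim:
  assumes w: "Vector_Spaces.linear scale scale w" and K: "subspace K" "\<And>z. z \<in> K \<Longrightarrow> w z \<in> K"
    and k: "(w ^^ k) e \<notin> K" "\<And>i. i > k \<Longrightarrow> (w ^^ i) e \<in> K"
  shows "dim (K \<union> (\<lambda>i. (w ^^ i) e) ` {..k}) = dim K + (k + 1)"
proof -
  \<comment> \<open>The string is built backwards from its end \<open>(w ^^ k) e\<close>;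
    \<open>d = 0\<close> is the empty string, with \<open>j = k + 1\<close>.\<close>
  have "dim (K \<union> (\<lambda>i. (w ^^ i) e) ` {j..k}) = dim K + d" if "j + d = k + 1" for j d
    using that
  proof (induct d arbitrary: j)
    case (Suc d)
    then have "{j..k} = insert j {Suc j..k}" by auto
    moreover have "(w ^^ j) e \<notin> span (K \<union> (\<lambda>i. (w ^^ i) e) ` {Suc j..k})"
      using Suc(2) by (intro string_notin_span assms) auto
    ultimately show ?case
      using Suc by (simp add: dim_insert)
  qed simp
  from this[of 0 "k + 1"] show ?thesis by (simp add: atMost_atLeast0)
qed

text \<open>In the case of equality \<open>w\<close> acts on \<open>S\<close> modulo
  \<open>K\<close> as a single Jordan block.\<close>

lemma string_in_subspace:
  assumes w: "Vector_Spaces.linear scale scale w" and K: "subspace K" "\<And>z. z \<in> K \<Longrightarrow> w z \<in> K"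
    and k: "(w ^^ k) e \<notin> K" "\<And>i. i > k \<Longrightarrow> (w ^^ i) e \<in> K"
    and S: "subspace S" "K \<subseteq> S" "\<And>i. (w ^^ i) e \<in> S"
  shows "dim K + (k + 1) \<le> dim S"
    and "dim S = dim K + (k + 1) \<Longrightarrow> span (K \<union> (\<lambda>i. (w ^^ i) e) ` {..k}) = S"
proof -
  have sub: "K \<union> (\<lambda>i. (w ^^ i) e) ` {..k} \<subseteq> S" using S by auto
  show "dim K + (k + 1) \<le> dim S"
    using dim_subset[OF sub] string_dim[OF w K k] by simp
  show "span (K \<union> (\<lambda>i. (w ^^ i) e) ` {..k}) = S" if "dim S = dim K + (k + 1)"
    using string_dim[OF w K k] that S(1) span_minimal[OF sub S(1)]
    by (intro subspace_dim_equal) auto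
qed

text \<open>The kernel of a single Jordan block is the line of its last vector. The coefficients of
  \<open>z\<close> along \<open>e\<close>, \<open>w e\<close>, and so on are shown to vanish one at
  a time.\<close>

lemma string_kernel:
  assumes w: "Vector_Spaces.linear scale scale w" and K: "subspace K" "\<And>z. z \<in> K \<Longrightarrow> w z \<in> K"
    and k: "(w ^^ k) e \<notin> K" "\<And>i. i > k \<Longrightarrow> (w ^^ i) e \<in> K"
    and z: "z \<in> span (K \<union> (\<lambda>i. (w ^^ i) e) ` {..k})" "w z \<in> K"
  shows "\<exists>c. z - scale c ((w ^^ k) e) \<in> K"
proof -
  let ?D = "\<lambda>j. span (K \<union> (\<lambda>i. (w ^^ i) e) ` {j..k})"
  have Kp: "z \<in> K \<Longrightarrow> (w ^^ i) z \<in> K" for i z by (induct i) (auto intro: K)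
  have "z \<in> ?D j" if "j \<le> k" for j using that
  proof (induct j)
    case 0
    then show ?case using z by (simp add: atMost_atLeast0)
  next
    case (Suc j)
    \<comment> \<open>As \<open>j < k\<close>, this power factors through \<open>w\<close> and sends
      \<open>z\<close> into \<open>K\<close>. It also sends the later vectors of the string into
      \<open>K\<close>, which isolates the coefficient at \<open>(w ^^ j) e\<close>.\<close>
    let ?f = "w ^^ (k - j)"
    interpret f: Vector_Spaces.linear scale scale ?f by (rule linear_funpow[OF w])
    have "{j..k} = insert j {Suc j..k}" using Suc by auto
    then obtain c where c: "z - scale c ((w ^^ j) e) \<in> ?D (Suc j)"
      using Suc by (auto simp: span_breakdown_eq)
    have "?f ((w ^^ i) e) \<in> K" if "j < i" for i
      using k(2)[of "k - j + i"] that Suc unfolding funpow_funpow by linarith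
    then have "K \<union> (\<lambda>i. (w ^^ i) e) ` {Suc j..k} \<subseteq> {z. ?f z \<in> K}"
      using Kp by auto
    then have "?D (Suc j) \<subseteq> {z. ?f z \<in> K}"
      by (rule span_minimal[OF _ f.subspace_linear_preimage[OF K(1)]])
    then have "?f (z - scale c ((w ^^ j) e)) \<in> K" using c by blast
    moreover have "?f z \<in> K"
    proof -
      have "?f = (w ^^ (k - Suc j)) \<circ> w"
        using Suc by (simp flip: funpow_Suc_right add: Suc_diff_Suc)
      then show ?thesis using Kp[OF z(2)] by simp
    qed
    moreover have "?f ((w ^^ j) e) = (w ^^ k) e"
      using Suc by (simp add: funpow_funpow)
    ultimately have "scale c ((w ^^ k) e) \<in> K"
      using subspace_diff[OF K(1), of "?f z" "?f (z - scale c ((w ^^ j) e))"]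
      by (simp add: f.diff f.scale)
    then have "c = 0"
      using k(1) subspace_scale[OF K(1), of "scale c ((w ^^ k) e)" "inverse c"]
      by (cases "c = 0") auto
    then show ?case using c by simp
  qed
  from this[of k] obtain c where "z - scale c ((w ^^ k) e) \<in> span K"
    by (auto simp: span_breakdown_eq)
  then show ?thesis using K(1) by (metis span_eq_iff)
qed

text \<open>This is the string bound for \<open>K = 0\<close>: the iterates of \<open>e\<close> up
  to the last nonzero one are independent vectors of \<open>S\<close>.\<close>

lemma nilpotent_on_subspace:
  assumes w: "Vector_Spaces.linear scale scale w" "nilpotent w" and S: "subspace S" "\<And>i. (w ^^ i) e \<in> S"
    and d: "dim S \<le> d"
  shows "(w ^^ d) e = 0"
proof (rule ccontr)
  assume nz: "(w ^^ d) e \<noteq> 0"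
  interpret w: Vector_Spaces.linear scale scale w by fact
  obtain M where M: "\<And>x. (w ^^ M) x = 0" using w(2) by (auto simp: nilpotent_def)
  have "\<exists>k. (w ^^ k) e \<noteq> 0 \<and> (\<forall>i. (w ^^ i) e \<noteq> 0 \<longrightarrow> i \<le> k)"
  proof (rule Nat.ex_has_greatest_nat[of "\<lambda>i. (w ^^ i) e \<noteq> 0"])
    show "\<forall>y. (w ^^ y) e \<noteq> 0 \<longrightarrow> y \<le> M"
    proof (intro allI impI)
      fix y assume "(w ^^ y) e \<noteq> 0"
      then show "y \<le> M"
        using M funpow_funpow[of M w "y - M" e] by (cases "y \<le> M") auto
    qed
  qed (use nz in auto)
  then obtain k where k: "(w ^^ k) e \<noteq> 0" "\<And>i. (w ^^ i) e \<noteq> 0 \<Longrightarrow> i \<le> k" by blast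
  have "dim {0} + (k + 1) \<le> dim S"
    by (rule string_in_subspace(1)[OF w(1)]) (use k S subspace_0 in \<open>auto dest: leD\<close>)
  moreover have "d \<le> k" using k(2) nz by blast
  ultimately show False using d by simp
qed

section \<open>The trace and its vanishing on nilpotent maps\<close>

definition trace :: "('b \<Rightarrow> 'b) \<Rightarrow> 'a" where
  "trace u = (\<Sum>i\<in>Basis. representation Basis (u i) i)"

lemma basis_expansion: "(\<Sum>i\<in>Basis. scale (representation Basis x i) i) = x"
  using independent_Basis span_Basis finite_Basis by (intro sum_representation_eq) auto

lemma representation_Basis_linear:
  "Vector_Spaces.linear scale (*) (\<lambda>x. representation Basis x i)"
  by (intro linear_representation independent_Basis span_Basis)

lemma trace_add: "trace (u + v) = trace u + trace v"
  using representation_Basis_linear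
  by (simp add: trace_def sum.distrib representation_add independent_Basis span_Basis)

lemma trace_commute:
  assumes f: "Vector_Spaces.linear scale scale f" and g: "Vector_Spaces.linear scale scale g"
  shows "trace (f \<circ> g) = trace (g \<circ> f)"
proof -
  let ?r = "representation Basis"
  have *: "?r (f (g i)) i = (\<Sum>j\<in>Basis. ?r (g i) j * ?r (f j) i)"
    if f: "Vector_Spaces.linear scale scale f" for f g :: "'b \<Rightarrow> 'b" and i
  proof -
    interpret f: Vector_Spaces.linear scale scale f by fact
    interpret r: Vector_Spaces.linear scale "(*)" "\<lambda>x. ?r x i" by (rule representation_Basis_linear)
    have "?r (f (g i)) i = ?r (f (\<Sum>j\<in>Basis. scale (?r (g i) j) j)) i"
      by (simp only: basis_expansion)
    then show ?thesis by (simp add: f.sum f.scale r.sum r.scale)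
  qed
  have "trace (f \<circ> g) = (\<Sum>i\<in>Basis. \<Sum>j\<in>Basis. ?r (g i) j * ?r (f j) i)"
    unfolding trace_def o_def by (intro sum.cong refl *[OF f])
  also have "\<dots> = (\<Sum>j\<in>Basis. \<Sum>i\<in>Basis. ?r (f j) i * ?r (g i) j)"
    by (subst sum.swap) (simp add: mult.commute)
  also have "\<dots> = trace (g \<circ> f)"
    unfolding trace_def o_def by (intro sum.cong refl *[OF g, symmetric])
  finally show ?thesis .
qed

text \<open>Precomposing with a projection onto the range of \<open>u ^^ j\<close> does not change the trace of \<open>u\<close>.\<close>

lemma trace_nilpotent:
  assumes u: "Vector_Spaces.linear scale scale u" "nilpotent u"
  shows "trace u = 0"
proof -
  interpret u: Vector_Spaces.linear scale scale u by fact
  have "\<exists>p. Vector_Spaces.linear scale scale p \<and> range p \<subseteq> range (u ^^ j) \<and>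
      (\<forall>x. p ((u ^^ j) x) = (u ^^ j) x) \<and> trace u = trace (u \<circ> p)" for j
  proof (induct j)
    case 0
    show ?case using linear_id by (intro exI[of _ id]) (simp add: o_def id_def)
  next
    case (Suc j)
    then obtain p where p: "Vector_Spaces.linear scale scale p" "range p \<subseteq> range (u ^^ j)"
      "\<And>x. p ((u ^^ j) x) = (u ^^ j) x" "trace u = trace (u \<circ> p)" by blast
    interpret uj: Vector_Spaces.linear scale scale "u ^^ Suc j" by (rule linear_funpow[OF u(1)])
    interpret vp: vector_space_pair scale scale ..
    have "subspace (range (u ^^ Suc j))" by (intro uj.subspace_image) simp
    then obtain q where q: "q ` UNIV \<subseteq> range (u ^^ Suc j)" "Vector_Spaces.linear scale scale q"
      "\<And>x. x \<in> range (u ^^ Suc j) \<Longrightarrow> q (id x) = x"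
      using vp.linear_exists_left_inverse_on[OF linear_id] by (metis inj_on_id)
    have "q ((u ^^ Suc j) x) = (u ^^ Suc j) x" for x using q(3) by simp
    moreover have "u (p x) \<in> range (u ^^ Suc j)" for x
    proof -
      obtain y where "p x = (u ^^ j) y" using p(2) by blast
      then show ?thesis by (intro image_eqI[of _ _ y]) auto
    qed
    \<comment> \<open>Since the projection \<open>q\<close> fixes the range of
      \<open>u \<circ> p\<close>, it can be inserted on the left; cyclicity of the trace moves it to
      the right, where it absorbs \<open>p\<close>.\<close>
    then have "u \<circ> p = q \<circ> (u \<circ> p)" using q(3) by (simp add: fun_eq_iff)
    then have "trace (u \<circ> p) = trace ((u \<circ> p) \<circ> q)"
      using trace_commute[OF q(2) Vector_Spaces.linear_compose[OF p(1) u(1)]] by simp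
    moreover have "p \<circ> q = q"
    proof
      fix x
      obtain y where "q x = (u ^^ Suc j) y" using q(1) by blast
      then have "q x = (u ^^ j) (u y)" by (simp add: funpow_swap1)
      then show "(p \<circ> q) x = q x" using p(3) by simp
    qed
    then have "(u \<circ> p) \<circ> q = u \<circ> q" by (simp add: comp_assoc)
    ultimately have "trace u = trace (u \<circ> q)" using p(4) by simp
    then show ?case using q by (intro exI[of _ q] conjI allI) (assumption | simp)+
  qed
  moreover obtain k where "\<And>x. (u ^^ k) x = 0" using u(2) by (auto simp: nilpotent_def)
  ultimately obtain p where p: "range p \<subseteq> range (u ^^ k)" "trace u = trace (u \<circ> p)" by blast
  have "u \<circ> p = (\<lambda>_. 0)"
  proof
    fix x
    obtain y where "p x = (u ^^ k) y" using p(1) by blast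
    then show "(u \<circ> p) x = 0" using \<open>\<And>x. (u ^^ k) x = 0\<close> by simp
  qed
  then have "trace u = trace (\<lambda>_. 0)" using p(2) by simp
  then show ?thesis by (simp add: trace_def representation_zero)
qed

end

text \<open>The coefficient of \<open>s\<^sup>i\<close> in \<open>(w + s v)\<^sup>r\<close>.\<close>

fun words :: "('b::{zero,plus} \<Rightarrow> 'b) \<Rightarrow> ('b \<Rightarrow> 'b) \<Rightarrow> nat \<Rightarrow> nat \<Rightarrow> 'b \<Rightarrow> 'b" where
  "words w v 0 0 z = z"
| "words w v 0 (Suc i) z = 0"
| "words w v (Suc r) 0 z = w (words w v r 0 z)"
| "words w v (Suc r) (Suc i) z = w (words w v r (Suc i) z) + v (words w v r i z)"

lemma words_0: "words w v r 0 z = (w ^^ r) z"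
  by (induct r) auto

context symplectic_space
begin

section \<open>Dual vectors and orthogonal complements\<close>

lemma right_module_hom: "module_hom scale (*) (b x)"
  using linear_right by (simp add: module_hom_iff_linear)

lemma left_module_hom: "module_hom scale (*) (\<lambda>x. b x y)"
  using linear_left by (simp add: module_hom_iff_linear)

lemmas b_simps =
  module_hom.add[OF right_module_hom] module_hom.diff[OF right_module_hom]
  module_hom.neg[OF right_module_hom] module_hom.zero[OF right_module_hom]
  module_hom.scale[OF right_module_hom] module_hom.sum[OF right_module_hom]
  module_hom.add[OF left_module_hom] module_hom.diff[OF left_module_hom]
  module_hom.neg[OF left_module_hom] module_hom.zero[OF left_module_hom]
  module_hom.scale[OF left_module_hom] module_hom.sum[OF left_module_hom]

lemma b_swap: "b y x = - b x y"
proof -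
  have "b (x + y) (x + y) = b x x + b y x + (b x y + b y y)" by (simp only: b_simps)
  then have "b y x + b x y = 0" by (simp only: alternating add_0_left add_0_right)
  then show ?thesis by (simp only: eq_neg_iff_add_eq_0)
qed

definition nondeg :: "'b set \<Rightarrow> bool" where
  "nondeg W \<longleftrightarrow> subspace W \<and> (\<forall>x\<in>W. (\<forall>y\<in>W. b x y = 0) \<longrightarrow> x = 0)"

definition orth :: "'b set \<Rightarrow> 'b set \<Rightarrow> 'b set" where
  "orth W N = {y \<in> W. \<forall>z\<in>N. b y z = 0}"

lemma nondeg_UNIV: "nondeg UNIV"
  using nondegenerate by (auto simp: nondeg_def)

lemma subspace_orth: "subspace W \<Longrightarrow> subspace (orth W N)"
  by (auto simp: orth_def subspace_def b_simps)

text \<open>A Gram-Schmidt step: \<open>a'\<close> is \<open>a\<close> made orthogonal to the old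
  dual vectors, and is nonzero by independence. A vector pairing to 1 with \<open>a'\<close> is
  corrected to \<open>ya\<close>, orthogonal to \<open>A\<close>; multiples of \<open>ya\<close>
  then correct the old dual vectors.\<close>

lemma dual_vectors:
  assumes "finite A" "nondeg W" "independent A" "A \<subseteq> W"
  shows "\<exists>Y. \<forall>a\<in>A. Y a \<in> W \<and> (\<forall>c\<in>A. b (Y a) c = (if c = a then 1 else 0))"
  using assms
proof (induct A)
  case (insert a A)
  have W: "subspace W" using insert by (auto simp: nondeg_def)
  obtain Y where Y: "\<And>c. c \<in> A \<Longrightarrow> Y c \<in> W"
    "\<And>c d. c \<in> A \<Longrightarrow> d \<in> A \<Longrightarrow> b (Y c) d = (if d = c then 1 else 0)"
    using insert by (metis independent_insert insert_subset)
  define a' where "a' = a - (\<Sum>c\<in>A. scale (b (Y c) a) c)"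
  have "(\<Sum>c\<in>A. scale (b (Y c) a) c) \<in> span A" by (intro span_sum span_scale span_base)
  moreover have "a \<notin> span A" using insert by (simp add: independent_insert)
  ultimately have "a' \<noteq> 0" by (auto simp: a'_def)
  moreover have a'W: "a' \<in> W"
    unfolding a'_def using insert W
    by (intro subspace_diff subspace_sum subspace_scale) auto
  ultimately obtain t0 where t0: "t0 \<in> W" "b a' t0 \<noteq> 0"
    using insert.prems(1) unfolding nondeg_def by blast
  define t where "t = scale (inverse (b t0 a')) t0"
  have t: "t \<in> W" "b t a' = 1"
    using t0 W b_swap[of a' t0] by (auto simp: t_def b_simps subspace_scale)
  have Ya': "b (Y c) a' = 0" if "c \<in> A" for c
    using that insert(1) Y(2)
    by (simp add: a'_def b_simps if_distrib[of "\<lambda>x. _ * x"] cong: if_cong sum.cong)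
  define ya where "ya = t - (\<Sum>c\<in>A. scale (b t c) (Y c))"
  have yaA: "b ya d = 0" if "d \<in> A" for d
    using that insert(1) Y(2)
    by (simp add: ya_def b_simps if_distrib[of "\<lambda>x. _ * x"] cong: if_cong sum.cong)
  have "b ya a' = 1" using t Ya' by (simp add: ya_def b_simps)
  moreover have "b ya a' = b ya a" using yaA by (simp add: a'_def b_simps)
  ultimately have yaa: "b ya a = 1" by simp
  have yaW: "ya \<in> W"
    unfolding ya_def using t Y W by (intro subspace_diff subspace_sum subspace_scale) auto
  define Z where "Z = (\<lambda>c. if c = a then ya else Y c - scale (b (Y c) a) ya)"
  have "Z c \<in> W" if "c \<in> insert a A" for c
    using that yaW Y W by (auto simp: Z_def intro: subspace_diff subspace_scale)
  moreover have "b (Z c) d = (if d = c then 1 else 0)" if "c \<in> insert a A" "d \<in> insert a A" for c d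
    using that insert(2) yaA yaa Y(2) by (auto simp: Z_def b_simps)
  ultimately show ?case by blast
qed auto

text \<open>Rank-nullity for the map \<open>f\<close> that records the values of \<open>b z\<close>
  on a basis of \<open>N\<close>: its kernel is the complement, and dual vectors show that its image
  is \<open>N\<close>.\<close>

lemma dim_orth:
  assumes W: "nondeg W" and N: "subspace N" "N \<subseteq> W"
  shows "dim (orth W N) + dim N = dim W"
proof -
  obtain B where B: "B \<subseteq> N" "independent B" "N \<subseteq> span B" "card B = dim N"
    by (rule basis_exists)
  have finB: "finite B" using B(2) by (rule finiteI_independent)
  obtain Y where Y: "\<And>a. a \<in> B \<Longrightarrow> Y a \<in> W"
    "\<And>a c. a \<in> B \<Longrightarrow> c \<in> B \<Longrightarrow> b (Y a) c = (if c = a then 1 else 0)"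
    using dual_vectors[OF finB W B(2)] B(1) N(2) by (metis subset_trans)
  define f where "f z = (\<Sum>c\<in>B. scale (b z c) c)" for z
  have f: "Vector_Spaces.linear scale scale f"
    by unfold_locales (auto simp: f_def b_simps sum.distrib algebra_simps scale_sum_right)
  have fY: "f (Y a) = a" if "a \<in> B" for a
  proof -
    have "f (Y a) = (\<Sum>c\<in>B. if c = a then c else 0)"
      unfolding f_def using Y that by (intro sum.cong) auto
    then show ?thesis using that finB by simp
  qed
  have sW: "subspace W" using W by (simp add: nondeg_def)
  have "f ` W \<subseteq> N"
    using B(1) N(1) by (auto simp: f_def intro!: subspace_sum subspace_scale)
  moreover have "N \<subseteq> f ` W"
  proof -
    interpret f: Vector_Spaces.linear scale scale f by fact
    have "B \<subseteq> f ` W" using fY Y(1) by (metis image_eqI subsetI)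
    then have "span B \<subseteq> f ` W" by (intro span_minimal f.subspace_image sW)
    then show ?thesis using B(3) by blast
  qed
  moreover have "{z \<in> W. f z = 0} = orth W N"
  proof -
    have "(\<forall>c\<in>N. b z c = 0)" if "f z = 0" for z
    proof -
      have "b z c = 0" if "c \<in> B" for c
        using independentD[OF B(2) finB _ _ that, of "b z"] \<open>f z = 0\<close> by (simp add: f_def)
      then have "B \<subseteq> {c. b z c = 0}" by auto
      then have "span B \<subseteq> {c. b z c = 0}" by (intro span_minimal module_hom.subspace_kernel[OF right_module_hom])
      then show ?thesis using B(3) by blast
    qed
    moreover have "f z = 0" if "\<forall>c\<in>N. b z c = 0" for z
      using that B(1) by (auto simp: f_def intro!: sum.neutral)
    ultimately show ?thesis by (auto simp: orth_def)
  qed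
  moreover interpret vp: vector_space_pair scale scale ..
  have "dim W = dim (f ` W) + dim {z \<in> W. f z = 0}"
    by (rule vp.rank_nullity_on[OF f sW finite_Basis]) (simp add: span_Basis)
  ultimately show ?thesis by (metis add.commute subset_antisym)
qed

text \<open>If \<open>z\<close> lay outside \<open>N\<close>, a vector dual to \<open>z\<close> in a
  basis of \<open>N\<close> extended by \<open>z\<close> would be orthogonal to \<open>N\<close> but
  not to \<open>z\<close>.\<close>

lemma orth_orth:
  assumes W: "nondeg W" and N: "subspace N" "N \<subseteq> W" and z: "z \<in> W"
    and 0: "\<And>y. y \<in> orth W N \<Longrightarrow> b y z = 0"
  shows "z \<in> N"
proof (rule ccontr)
  assume "z \<notin> N"
  obtain B where B: "B \<subseteq> N" "independent B" "N \<subseteq> span B" "card B = dim N"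
    by (rule basis_exists)
  have spB: "span B = N" using B N by (metis span_subspace)
  then have iB: "independent (insert z B)" using \<open>z \<notin> N\<close> B(2) by (simp add: independent_insert)
  obtain Y where Y: "\<And>a. a \<in> insert z B \<Longrightarrow> Y a \<in> W"
    "\<And>a c. a \<in> insert z B \<Longrightarrow> c \<in> insert z B \<Longrightarrow> b (Y a) c = (if c = a then 1 else 0)"
    using dual_vectors[OF finiteI_independent[OF iB] W iB] B(1) N(2) z
    by (metis insert_subset subset_trans)
  have "B \<subseteq> {c. b (Y z) c = 0}" using Y(2)[of z] \<open>z \<notin> N\<close> B(1) by auto
  then have "span B \<subseteq> {c. b (Y z) c = 0}" by (intro span_minimal module_hom.subspace_kernel[OF right_module_hom])
  then have "Y z \<in> orth W N" using Y(1) spB by (auto simp: orth_def)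
  then show False using 0[of "Y z"] Y(2)[of z z] by simp
qed

section \<open>Spaces of nilpotent symmetric endomorphisms\<close>

sublocale fn: vector_space "fun_scale scale"
  by (rule vector_space_fun_scale) unfold_locales

lemma fn_eval_linear: "Vector_Spaces.linear (fun_scale scale) scale (\<lambda>u. u x)"
  by unfold_locales (auto simp: fun_scale_def algebra_simps)

abbreviation lin :: "('b \<Rightarrow> 'b) \<Rightarrow> bool" where "lin \<equiv> Vector_Spaces.linear scale scale"

lemma linD:
  assumes "lin u"
  shows "u (x + y) = u x + u y" "u (x - y) = u x - u y" "u 0 = 0" "u (- x) = - u x"
    "u (scale c x) = scale c (u x)" "u (sum f A) = (\<Sum>i\<in>A. u (f i))"
proof -
  interpret u: Vector_Spaces.linear scale scale u by fact
  show "u (x + y) = u x + u y" "u (x - y) = u x - u y" "u 0 = 0" "u (- x) = - u x"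
    "u (scale c x) = scale c (u x)" "u (sum f A) = (\<Sum>i\<in>A. u (f i))"
    by (rule u.add u.diff u.zero u.neg u.scale u.sum)+
qed

lemma linI:
  assumes "\<And>x y. u (x + y) = u x + u y" "\<And>c x. u (scale c x) = scale c (u x)"
  shows "lin u"
  using assms by unfold_locales auto

lemma symmetric_endosD:
  assumes "u \<in> symmetric_endos"
  shows "lin u" "b x (u y) = b y (u x)" "b (u x) y = - b x (u y)"
proof -
  show "lin u" "b x (u y) = b y (u x)" using assms by (auto simp: symmetric_endos_def)
  then show "b (u x) y = - b x (u y)" using b_swap[of "u x" y] by simp
qed

lemma symmetric_endos_funpow:
  assumes "u \<in> symmetric_endos"
  shows "b ((u ^^ k) x) y = (- 1) ^ k * b x ((u ^^ k) y)"
proof (induct k arbitrary: x y)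
  case (Suc k)
  have "b ((u ^^ Suc k) x) y = - b ((u ^^ k) x) (u y)"
    using symmetric_endosD(3)[OF assms] by simp
  also have "\<dots> = - ((- 1) ^ k * b x ((u ^^ k) (u y)))" by (simp only: Suc)
  finally show ?case by (simp add: funpow_swap1)
qed simp

definition sym_tensor :: "'b \<Rightarrow> 'b \<Rightarrow> 'b \<Rightarrow> 'b" where
  "sym_tensor x y = (\<lambda>z. scale (b x z) y + scale (b y z) x)"

lemma sym_tensor_linear: "Vector_Spaces.linear scale (fun_scale scale) (sym_tensor x)"
  by unfold_locales (auto simp: sym_tensor_def fun_scale_def b_simps algebra_simps fun_eq_iff)

lemma trace_rank_one: "trace (\<lambda>z. scale (b x z) t) = b x t"
proof -
  have "trace (\<lambda>z. scale (b x z) t) = (\<Sum>i\<in>Basis. representation Basis t i * b x i)"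
    by (simp add: trace_def representation_scale independent_Basis span_Basis mult.commute)
  also have "\<dots> = b x (\<Sum>i\<in>Basis. scale (representation Basis t i) i)"
    by (simp add: b_simps)
  finally show ?thesis by (simp only: basis_expansion)
qed

lemma nilpotent_comp_self: "nilpotent u \<Longrightarrow> nilpotent (u \<circ> u)"
proof -
  assume "nilpotent u"
  then obtain k where k: "\<And>x. (u ^^ k) x = 0" by (auto simp: nilpotent_def)
  have "u \<circ> u = u ^^ 2" by (simp add: numeral_2_eq_2)
  then have "((u \<circ> u) ^^ k) = u ^^ (k + k)" by (simp only: funpow_mult mult_2_right mult.commute)
  then have "((u \<circ> u) ^^ k) x = 0" for x using k by (simp add: funpow_add)
  then show ?thesis by (auto simp: nilpotent_def)
qed

text \<open>The space of all functions may be infinite-dimensional, and \<open>dim\<close> is \<open>0\<close> on a subspace without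
  finite basis; hence the finite spanning set.\<close>

definition nilspace :: "'b set \<Rightarrow> ('b \<Rightarrow> 'b) set \<Rightarrow> bool" where
  "nilspace W V \<longleftrightarrow> nondeg W \<and> fn.subspace V \<and> (\<exists>G. finite G \<and> V \<subseteq> fn.span G) \<and>
     (\<forall>u\<in>V. u \<in> symmetric_endos \<and> nilpotent u \<and> range u \<subseteq> W)"

lemma nilspaceD:
  assumes "nilspace W V"
  shows "nondeg W" "subspace W" "fn.subspace V" "\<exists>G. finite G \<and> V \<subseteq> fn.span G"
    "u \<in> V \<Longrightarrow> u \<in> symmetric_endos" "u \<in> V \<Longrightarrow> lin u" "u \<in> V \<Longrightarrow> nilpotent u" "u \<in> V \<Longrightarrow> u x \<in> W"
  using assms symmetric_endosD(1) unfolding nilspace_def nondeg_def by blast+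

lemma nilspace_comb:
  assumes "nilspace W V" "u \<in> V" "v \<in> V"
  shows "(\<lambda>z. u z + scale s (v z)) \<in> V"
proof -
  have "u + fun_scale scale s v \<in> V"
    using nilspaceD(3)[OF assms(1)] assms(2,3) by (intro fn.subspace_add fn.subspace_scale)
  then show ?thesis by (simp add: plus_fun_def fun_scale_def)
qed

lemma nilspace_no_eigenvalue:
  assumes "nilspace W V" "u \<in> V" "x \<noteq> 0" "u x = scale c x"
  shows "c = 0"
proof (rule ccontr)
  assume "c \<noteq> 0"
  have "(u ^^ k) x = scale (c ^ k) x" for k
    using assms(4) linD(5)[OF nilspaceD(6)[OF assms(1,2)]] by (induct k) (simp_all add: mult.commute)
  moreover obtain k where "(u ^^ k) x = 0"
    using nilspaceD(7)[OF assms(1,2)] by (auto simp: nilpotent_def)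
  ultimately show False using assms(3) \<open>c \<noteq> 0\<close> by simp
qed

text \<open>The trace form vanishes on \<open>V\<close>, since squares of nilpotent maps are nilpotent.\<close>

lemma sym_tensor_orthogonal:
  assumes two: "(2::'a) \<noteq> 0" and V: "nilspace W V" and v: "v \<in> V" and t: "sym_tensor x y \<in> V"
  shows "b y (v x) = 0"
proof -
  let ?C = "sym_tensor x y"
  have sq: "trace (u \<circ> u) = 0" if "u \<in> V" for u
    using nilspaceD(6,7)[OF V that] Vector_Spaces.linear_compose
    by (intro trace_nilpotent nilpotent_comp_self) auto
  have "v + ?C \<in> V" using nilspaceD(3)[OF V] v t by (rule fn.subspace_add)
  moreover have "(v + ?C) \<circ> (v + ?C) = ((v \<circ> v) + (?C \<circ> ?C)) + ((v \<circ> ?C) + (?C \<circ> v))"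
    using linD(1)[OF nilspaceD(6)[OF V v]] linD(1)[OF nilspaceD(6)[OF V t]]
    by (auto simp: fun_eq_iff)
  ultimately have "trace (v \<circ> ?C) + trace (?C \<circ> v) = 0"
    using sq[of "v + ?C"] sq[OF v] sq[OF t] by (simp add: trace_add)
  moreover have "trace (?C \<circ> v) = trace (v \<circ> ?C)"
    using nilspaceD(6)[OF V] v t by (intro trace_commute) auto
  \<comment> \<open>The two rank-one summands have traces \<open>b x (v y)\<close> and
    \<open>b y (v x)\<close>, which agree by symmetry of \<open>v\<close>. Both mixed traces
    together are thus 4 times \<open>b y (v x)\<close>.\<close>
  moreover have "v \<circ> ?C = (\<lambda>z. scale (b x z) (v y)) + (\<lambda>z. scale (b y z) (v x))"
    using linD[OF nilspaceD(6)[OF V v]] by (auto simp: sym_tensor_def fun_eq_iff)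
  then have "trace (v \<circ> ?C) = 2 * b y (v x)"
    using symmetric_endosD(2)[OF nilspaceD(5)[OF V v], of x y]
    by (simp add: trace_add trace_rank_one)
  ultimately have "2 * (2 * b y (v x)) = 0" by (simp only: mult_2)
  then show ?thesis using two by (simp only: mult_eq_0_iff) simp
qed

section \<open>Reduction to the orthogonal complement of a hyperbolic pair\<close>

text \<open>This is \<open>N\<^sub>x\<close>. Only single maps of \<open>V\<close> are applied, not
  products; stability under \<open>V\<close> is proved later for special \<open>x\<close>.\<close>

definition orbit_span :: "('b \<Rightarrow> 'b) set \<Rightarrow> 'b \<Rightarrow> 'b set" where
  "orbit_span V x = span (insert x ((\<lambda>u. u x) ` V))"

context
  fixes W V x
  assumes V: "nilspace W V" and x: "x \<in> W" "x \<noteq> 0"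
begin

lemma subspace_eval: "subspace ((\<lambda>u. u x) ` V)"
  by (rule module_hom.subspace_image[OF _ nilspaceD(3)[OF V]])
    (use fn_eval_linear in \<open>simp add: module_hom_iff_linear\<close>)

lemma orbit_span_iff: "z \<in> orbit_span V x \<longleftrightarrow> (\<exists>a. \<exists>u\<in>V. z = scale a x + u x)"
proof -
  have "z \<in> orbit_span V x \<longleftrightarrow> (\<exists>a. z - scale a x \<in> (\<lambda>u. u x) ` V)"
    unfolding orbit_span_def span_breakdown_eq using subspace_eval by (simp add: span_eq_iff[THEN iffD2])
  then show ?thesis by (auto simp: image_iff algebra_simps)
qed

lemma subspace_orbit_span: "subspace (orbit_span V x)" by (simp add: orbit_span_def)

lemma orbit_span_base: "x \<in> orbit_span V x" "u \<in> V \<Longrightarrow> u x \<in> orbit_span V x"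
  by (auto simp: orbit_span_def intro: span_base)

lemma orbit_span_subset: "orbit_span V x \<subseteq> W"
  unfolding orbit_span_def using nilspaceD[OF V] x by (intro span_minimal) auto

lemma dim_orbit_span: "dim (orbit_span V x) = dim ((\<lambda>u. u x) ` V) + 1"
proof -
  have "x \<notin> (\<lambda>u. u x) ` V"
  proof
    assume "x \<in> (\<lambda>u. u x) ` V"
    then obtain u where "u \<in> V" "u x = scale 1 x" by auto
    then show False using nilspace_no_eigenvalue[OF V _ x(2)] by fastforce
  qed
  then have "x \<notin> span ((\<lambda>u. u x) ` V)" using subspace_eval by (simp add: span_eq_iff[THEN iffD2])
  then show ?thesis by (simp add: orbit_span_def dim_insert)
qed

definition "fixator = {u \<in> V. u x = 0}"
text \<open>Through \<open>sym_tensor x\<close> these vectors parametrise the maps in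
  \<open>fixator\<close> with zero compression, by \<open>compress_kernel\<close>.\<close>

definition "tensor_partners = {y \<in> W. b x y = 0 \<and> sym_tensor x y \<in> V}"

lemma subspace_fixator: "fn.subspace fixator"
  using nilspaceD(3)[OF V] by (auto simp: fn.subspace_def fixator_def fun_scale_def)

lemma fixator_perp: "u \<in> fixator \<Longrightarrow> b x (u z) = 0"
  using symmetric_endosD(2)[OF nilspaceD(5)[OF V], of u x z] by (simp add: fixator_def b_simps)

lemma subspace_tensor_partners: "subspace tensor_partners"
proof -
  interpret t: Vector_Spaces.linear scale "fun_scale scale" "sym_tensor x" by (rule sym_tensor_linear)
  show ?thesis
    using nilspaceD(2,3)[OF V]
    by (auto simp: subspace_def fn.subspace_def tensor_partners_def b_simps t.add t.scale t.zero
        simp del: zero_fun_apply plus_fun_apply)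
qed

text \<open>With \<open>dim_orth\<close>, this bounds the joint contribution of
  \<open>orbit_span\<close> and \<open>tensor_partners\<close> in \<open>dim_reduction\<close> by
  \<open>dim W\<close>.\<close>

lemma tensor_partners_subset:
  assumes two: "(2::'a) \<noteq> 0"
  shows "tensor_partners \<subseteq> orth W (orbit_span V x)"
proof
  fix y assume y: "y \<in> tensor_partners"
  then have "b y x = 0" using b_swap[of x y] by (simp add: tensor_partners_def)
  moreover have "b y (u x) = 0" if "u \<in> V" for u
    using sym_tensor_orthogonal[OF two V that] y by (simp add: tensor_partners_def)
  ultimately show "y \<in> orth W (orbit_span V x)"
    using y by (auto simp: orth_def orbit_span_iff b_simps tensor_partners_def)
qed

context
  fixes x'
  assumes x': "x' \<in> W" "b x x' = 1"
begin

text \<open>The orthogonal projection along the hyperbolic pair \<open>x\<close>, \<open>x'\<close>.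
  On the complement of \<open>x\<close> it only adds multiples of \<open>x\<close>, so
  \<open>pr \<circ> u \<circ> pr\<close> models the map induced by \<open>u\<close> on that
  complement modulo \<open>x\<close>.\<close>

definition "pr z = z - scale (b x z) x' + scale (b x' z) x"
definition "reduced_space = {z \<in> W. b x z = 0 \<and> b x' z = 0}"
definition "reduced_maps = (\<lambda>u. pr \<circ> u \<circ> pr) ` fixator"

lemma bx'x: "b x' x = - 1" using b_swap[of x' x] x' by simp

lemma pr_lin: "lin pr" by (rule linI) (auto simp: pr_def b_simps algebra_simps)

lemma pr_simps [simp]: "b x (pr z) = 0" "b x' (pr z) = 0" "pr x = 0" "pr (pr z) = pr z"
  by (simp_all add: pr_def b_simps x' bx'x alternating)

lemma pr_perp: "b x z = 0 \<Longrightarrow> pr z = z + scale (b x' z) x"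
  by (simp add: pr_def)

lemma pr_adjoint: "b (pr z) t = b z (pr t)"
  using b_swap[of z x] b_swap[of z x'] by (simp add: pr_def b_simps)

lemma pr_in: "z \<in> W \<Longrightarrow> pr z \<in> reduced_space"
  using x x' nilspaceD(2)[OF V]
  by (auto simp: reduced_space_def) (auto simp: pr_def intro!: subspace_add subspace_diff subspace_scale)

lemma pr_id: "z \<in> reduced_space \<Longrightarrow> pr z = z"
  by (simp add: reduced_space_def pr_def)

lemma reduced_space_eq: "reduced_space = orth W (span {x, x'})"
proof -
  have "(\<forall>t\<in>span {x, x'}. b z t = 0) \<longleftrightarrow> b z x = 0 \<and> b z x' = 0" for z
  proof
    assume "b z x = 0 \<and> b z x' = 0"
    then have "span {x, x'} \<subseteq> {t. b z t = 0}"
      by (intro span_minimal module_hom.subspace_kernel[OF right_module_hom]) auto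
    then show "\<forall>t\<in>span {x, x'}. b z t = 0" by blast
  qed (simp add: span_base)
  then show ?thesis using b_swap[of x] b_swap[of x'] by (auto simp: reduced_space_def orth_def)
qed

lemma nondeg_reduced_space: "nondeg reduced_space"
proof -
  have "subspace reduced_space" using nilspaceD(2)[OF V] by (simp add: reduced_space_eq subspace_orth)
  moreover have "z = 0" if z: "z \<in> reduced_space" "\<forall>y\<in>reduced_space. b z y = 0" for z
  proof -
    have "b z y = 0" if "y \<in> W" for y
      using z pr_in[OF that] pr_adjoint[of z y] pr_id[OF z(1)] by simp
    then show ?thesis using nilspaceD(1)[OF V] z(1) by (auto simp: nondeg_def reduced_space_def)
  qed
  ultimately show ?thesis by (auto simp: nondeg_def)
qed

lemma dim_reduced_space: "dim reduced_space + 2 = dim W"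
proof -
  have "x' \<notin> span {x}" using x' by (auto simp: span_singleton b_simps alternating)
  then have "dim (span {x, x'}) = 2"
    using x(2) by (simp add: insert_commute[of x x'] dim_insert)
  moreover have "span {x, x'} \<subseteq> W"
    using x x' nilspaceD(2)[OF V] by (intro span_minimal) auto
  ultimately show ?thesis
    using dim_orth[OF nilspaceD(1)[OF V], of "span {x, x'}"] by (simp add: reduced_space_eq)
qed

lemma fixator_pr: "u \<in> fixator \<Longrightarrow> b x z = 0 \<Longrightarrow> u (pr z) = u z"
  using linD[OF nilspaceD(6)[OF V], of u] by (simp add: fixator_def pr_perp)

text \<open>On the complement of \<open>x\<close>, \<open>pr\<close> changes a vector by a multiple
  of \<open>x\<close>, which \<open>u\<close> kills.\<close>

lemma compress_funpow:
  assumes u: "u \<in> fixator" and z: "b x z = 0"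
  shows "((pr \<circ> u \<circ> pr) ^^ k) (pr z) = pr ((u ^^ k) z)"
proof (induct k)
  case (Suc k)
  have "b x ((u ^^ k) z) = 0" using z fixator_perp[OF u] by (cases k) auto
  then show ?case using Suc fixator_pr[OF u] by simp
qed simp

lemma compress_linear: "Vector_Spaces.linear (fun_scale scale) (fun_scale scale) (\<lambda>u. pr \<circ> u \<circ> pr)"
  by unfold_locales (auto simp: fun_scale_def fun_eq_iff linD[OF pr_lin])

lemma fg_subset: "\<exists>G. finite G \<and> fixator \<subseteq> fn.span G"
  using nilspaceD(4)[OF V] by (auto simp: fixator_def)

lemma nilspace_reduced_maps: "nilspace reduced_space reduced_maps"
proof -
  interpret c: Vector_Spaces.linear "fun_scale scale" "fun_scale scale" "\<lambda>u. pr \<circ> u \<circ> pr"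
    by (rule compress_linear)
  obtain G where G: "finite G" "fixator \<subseteq> fn.span G" using fg_subset by blast
  have "reduced_maps \<subseteq> fn.span ((\<lambda>u. pr \<circ> u \<circ> pr) ` G)"
    unfolding reduced_maps_def using G(2) by (rule c.spans_image)
  moreover have "fn.subspace reduced_maps" unfolding reduced_maps_def by (rule c.subspace_image[OF subspace_fixator])
  moreover have "pr \<circ> u \<circ> pr \<in> symmetric_endos \<and> nilpotent (pr \<circ> u \<circ> pr) \<and>
      range (pr \<circ> u \<circ> pr) \<subseteq> reduced_space"
    if u: "u \<in> fixator" for u
  proof (intro conjI)
    have uV: "u \<in> V" using u by (simp add: fixator_def)
    have "lin (pr \<circ> u \<circ> pr)"
      using Vector_Spaces.linear_compose[OF Vector_Spaces.linear_compose[OF pr_lin nilspaceD(6)[OF V uV]] pr_lin]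
      by (simp add: o_assoc)
    moreover have "b s (pr (u (pr t))) = b t (pr (u (pr s)))" for s t
      using symmetric_endosD(2)[OF nilspaceD(5)[OF V uV], of "pr s" "pr t"] by (simp add: pr_adjoint)
    ultimately show "pr \<circ> u \<circ> pr \<in> symmetric_endos" by (simp add: symmetric_endos_def)
    obtain k where k: "\<And>z. (u ^^ k) z = 0" using nilspaceD(7)[OF V uV] by (auto simp: nilpotent_def)
    \<comment> \<open>One extra power, since \<open>compress_funpow\<close> needs a vector
      orthogonal to \<open>x\<close>; \<open>u (pr z)\<close> is one.\<close>
    have "((pr \<circ> u \<circ> pr) ^^ Suc k) z = 0" for z
    proof -
      have "((pr \<circ> u \<circ> pr) ^^ Suc k) z = ((pr \<circ> u \<circ> pr) ^^ k) (pr (u (pr z)))"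
        by (simp add: funpow_swap1)
      then show ?thesis
        using compress_funpow[OF u fixator_perp[OF u]] k linD(3)[OF pr_lin] by simp
    qed
    then show "nilpotent (pr \<circ> u \<circ> pr)" unfolding nilpotent_def by blast
    show "range (pr \<circ> u \<circ> pr) \<subseteq> reduced_space" using pr_in nilspaceD(8)[OF V uV] by auto
  qed
  ultimately show ?thesis
    unfolding nilspace_def using nondeg_reduced_space G(1) by (auto simp: reduced_maps_def)
qed

lemma compress_kernel:
  assumes two: "(2::'a) \<noteq> 0" and u: "u \<in> symmetric_endos" "range u \<subseteq> W" "u x = 0"
    and 0: "\<And>z. pr (u (pr z)) = 0"
  shows "\<exists>y\<in>W. b x y = 0 \<and> u = sym_tensor x y"
proof -
  note l = linD[OF symmetric_endosD(1)[OF u(1)]]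
  have p: "b x (u z) = 0" for z
    using symmetric_endosD(2)[OF u(1), of x z] u(3) by (simp add: b_simps)
  \<comment> \<open>Evaluating \<open>u = sym_tensor x y\<close> at \<open>x'\<close> with
    \<open>y = u x' + c x\<close> forces \<open>2 c = b x' (u x')\<close>.\<close>
  define y where "y = u x' + scale (b x' (u x') / 2) x"
  have "y \<in> W" unfolding y_def
    using u(2) x nilspaceD(2)[OF V] by (intro subspace_add subspace_scale) auto
  moreover have "b x y = 0" by (simp add: y_def b_simps p alternating)
  moreover have "u z = sym_tensor x y z" for z
  proof -
    have "z = pr z + scale (b x z) x' - scale (b x' z) x" by (simp add: pr_def)
    then have "u z = u (pr z + scale (b x z) x' - scale (b x' z) x)" by simp
    also have "\<dots> = u (pr z) + scale (b x z) (u x')" by (simp add: l u(3))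
    also have "u (pr z) = - scale (b x' (u (pr z))) x"
      using 0[of z] pr_perp[OF p, of "pr z"] by (simp add: eq_neg_iff_add_eq_0)
    also have "b x' (u (pr z)) = b (pr z) (u x')" by (rule symmetric_endosD(2)[OF u(1)])
    also have "\<dots> = b z (u x' + scale (b x' (u x')) x)"
      by (simp add: pr_adjoint pr_perp[OF p])
    finally have "u z = scale (b x z) (u x') - scale (b z (u x') + b x' (u x') * b z x) x"
      by (simp add: b_simps)
    moreover have "b z (u x') + b x' (u x') * b z x = - (b (u x') z + b x' (u x') * b x z)"
      by (simp add: b_swap[of z x] b_swap[of z "u x'"])
    ultimately have uz: "u z = scale (b x z) (u x') + scale (b (u x') z + b x' (u x') * b x z) x"
      by (simp only: scale_minus_left diff_minus_eq_add)
    have "sym_tensor x y z = scale (b x z) (u x') + (scale (b x z * (b x' (u x') / 2)) x +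
        scale (b (u x') z + b x' (u x') / 2 * b x z) x)"
      by (simp add: sym_tensor_def y_def b_simps scale_right_distrib add.assoc)
    also have "\<dots> = scale (b x z) (u x') +
        scale (b (u x') z + (b x' (u x') / 2 + b x' (u x') / 2) * b x z) x"
      by (simp only: scale_left_distrib[symmetric]) (simp only: algebra_simps)
    also have "b x' (u x') / 2 + b x' (u x') / 2 = b x' (u x')"
      using two by (simp add: field_simps)
    finally show ?thesis using uz by simp
  qed
  ultimately show ?thesis by (intro bexI[of _ y]) auto
qed

text \<open>Rank-nullity twice: evaluation at \<open>x\<close> on \<open>V\<close> has kernel
  \<open>fixator\<close>, and compression on \<open>fixator\<close> has kernel
  \<open>sym_tensor x\<close> followed by \<open>tensor_partners\<close> as argument set. The 1 on
  the left accounts for \<open>x\<close> itself in \<open>orbit_span V x\<close>.\<close>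

lemma dim_reduction:
  assumes two: "(2::'a) \<noteq> 0"
  shows "fn.dim V + 1 = dim (orbit_span V x) + fn.dim reduced_maps + dim tensor_partners"
proof -
  interpret p1: vector_space_pair "fun_scale scale" scale ..
  interpret p2: vector_space_pair "fun_scale scale" "fun_scale scale" ..
  interpret p3: vector_space_pair scale "fun_scale scale" ..
  interpret t: Vector_Spaces.linear scale "fun_scale scale" "sym_tensor x" by (rule sym_tensor_linear)
  obtain G where G: "finite G" "V \<subseteq> fn.span G" using nilspaceD(4)[OF V] by blast
  have "fn.dim V = dim ((\<lambda>u. u x) ` V) + fn.dim fixator"
    using p1.rank_nullity_on[OF fn_eval_linear nilspaceD(3)[OF V] G] by (simp add: fixator_def)
  moreover have "fn.dim fixator = fn.dim reduced_maps + fn.dim (sym_tensor x ` tensor_partners)"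
  proof -
    have "{u \<in> fixator. pr \<circ> u \<circ> pr = 0} = sym_tensor x ` tensor_partners"
    proof (intro equalityI subsetI)
      fix u assume u: "u \<in> {u \<in> fixator. pr \<circ> u \<circ> pr = 0}"
      then have "\<exists>y\<in>W. b x y = 0 \<and> u = sym_tensor x y"
        using nilspaceD[OF V] by (intro compress_kernel[OF two]) (auto simp: fixator_def fun_eq_iff)
      then show "u \<in> sym_tensor x ` tensor_partners" using u by (auto simp: tensor_partners_def fixator_def)
    next
      fix u assume "u \<in> sym_tensor x ` tensor_partners"
      then obtain y where y: "u = sym_tensor x y" "b x y = 0" "sym_tensor x y \<in> V" by (auto simp: tensor_partners_def)
      have "sym_tensor x y x = 0" using b_swap[of y x] y by (simp add: sym_tensor_def alternating)
      moreover have "pr \<circ> sym_tensor x y \<circ> pr = 0"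
        by (auto simp: sym_tensor_def fun_eq_iff linD[OF pr_lin])
      ultimately show "u \<in> {u \<in> fixator. pr \<circ> u \<circ> pr = 0}"
        using y by (simp add: fixator_def)
    qed
    moreover have "fixator \<subseteq> fn.span G" using G by (auto simp: fixator_def)
    ultimately show ?thesis
      using p2.rank_nullity_on[OF compress_linear subspace_fixator G(1)] by (simp add: reduced_maps_def)
  qed
  moreover have "fn.dim (sym_tensor x ` tensor_partners) = dim tensor_partners"
  proof -
    have "y = 0" if "sym_tensor x y = 0" for y
    proof -
      have 1: "y = - scale (b y x') x"
        using fun_cong[OF that, of x'] x' by (simp add: sym_tensor_def eq_neg_iff_add_eq_0)
      then have "b y x' = - b y x'" using x' by (metis b_simps(9,11) mult.right_neutral mult_minus_right)
      then have "2 * b y x' = 0" by (metis add.right_inverse mult_2)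
      then show ?thesis using 1 two by simp
    qed
    then have "{y \<in> tensor_partners. sym_tensor x y = 0} = {0}"
      using subspace_0[OF subspace_tensor_partners] t.zero by auto
    moreover have "tensor_partners \<subseteq> span Basis" by (simp add: span_Basis)
    ultimately show ?thesis
      using p3.rank_nullity_on[OF sym_tensor_linear[of x] subspace_tensor_partners finite_Basis] by simp
  qed
  ultimately show ?thesis by (simp add: dim_orbit_span)
qed

end

end

section \<open>Coefficients of the powers of \<open>w + s v\<close>\<close>

lemma words_eq_0: "lin w \<Longrightarrow> lin v \<Longrightarrow> r < i \<Longrightarrow> words w v r i z = 0"
proof (induct r arbitrary: i)
  case 0
  then show ?case by (cases i) auto
next
  case (Suc r)
  then show ?case by (cases i) (auto simp: linD(3))
qed

lemma words_diag: "lin w \<Longrightarrow> lin v \<Longrightarrow> words w v r r z = (v ^^ r) z"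
  by (induct r) (auto simp: words_eq_0 linD(3))

lemma words_mem:
  assumes "subspace S" "\<And>z. z \<in> S \<Longrightarrow> w z \<in> S" "\<And>z. z \<in> S \<Longrightarrow> v z \<in> S" "z \<in> S"
  shows "words w v r i z \<in> S"
  using assms by (induct w v r i z rule: words.induct) (auto intro: subspace_add subspace_0)

lemma words_expand:
  assumes w: "lin w" and v: "lin v"
  shows "((\<lambda>z. w z + scale s (v z)) ^^ r) z = (\<Sum>i\<le>r. scale (s ^ i) (words w v r i z))"
proof (induct r)
  case (Suc r)
  let ?T = "words w v r"
  have "((\<lambda>z. w z + scale s (v z)) ^^ Suc r) z =
      (\<Sum>i\<le>r. scale (s ^ i) (w (?T i z))) + (\<Sum>i\<le>r. scale (s ^ Suc i) (v (?T i z)))"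
    using Suc by (simp add: linD[OF w] linD[OF v] scale_sum_right)
  also have "(\<Sum>i\<le>r. scale (s ^ i) (w (?T i z))) = (\<Sum>i\<le>Suc r. scale (s ^ i) (w (?T i z)))"
    by (simp add: words_eq_0[OF w v] linD(3)[OF w])
  also have "\<dots> = w (?T 0 z) + (\<Sum>i\<le>r. scale (s ^ Suc i) (w (?T (Suc i) z)))"
    by (subst sum.atMost_Suc_shift) simp
  also have "\<dots> + (\<Sum>i\<le>r. scale (s ^ Suc i) (v (?T i z))) =
      (\<Sum>i\<le>Suc r. scale (s ^ i) (words w v (Suc r) i z))"
    by (subst sum.atMost_Suc_shift) (simp add: scale_right_distrib sum.distrib add.assoc)
  finally show ?case .
qed simp

text \<open>By double orthogonality it suffices to test with the functionals \<open>b y\<close> for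
  \<open>y\<close> orthogonal to \<open>N\<close>, which leaves scalar polynomials.\<close>

lemma polynomial_coeffs_in_subspace:
  assumes F: "infinite (UNIV :: 'a set) \<or> r \<le> card (UNIV :: 'a set)" and N: "subspace N"
    and 0: "\<And>s. (\<Sum>i<r. scale (s ^ i) (a i)) \<in> N" and i: "i < r"
  shows "a i \<in> N"
proof (rule orth_orth[OF nondeg_UNIV N])
  fix y assume y: "y \<in> orth UNIV N"
  show "b y (a i) = 0"
  proof (rule vanishing_polynomial_coeffs[OF F _ i])
    fix s
    show "(\<Sum>i<r. s ^ i * b y (a i)) = 0"
      using y 0[of s] by (auto simp: orth_def b_simps dest!: bspec)
  qed
qed auto

text \<open>The inequality is strict because a polynomial of degree \<open>r\<close> in
  \<open>s\<close> has \<open>r + 1\<close> coefficients.\<close>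

lemma words_in_subspace:
  assumes V: "nilspace W V" and F: "infinite (UNIV :: 'a set) \<or> r < card (UNIV :: 'a set)"
    and N: "subspace N" and w: "w \<in> V" and v: "v \<in> V" and 0: "\<And>u. u \<in> V \<Longrightarrow> (u ^^ r) z \<in> N"
  shows "words w v r i z \<in> N"
proof (cases "i \<le> r")
  case True
  note l = nilspaceD(6)[OF V w] nilspaceD(6)[OF V v]
  show ?thesis
  proof (rule polynomial_coeffs_in_subspace[OF _ N, of "Suc r"])
    show "(\<Sum>i<Suc r. scale (s ^ i) (words w v r i z)) \<in> N" for s
      using 0[OF nilspace_comb[OF V w v, of s]] words_expand[OF l] by (simp add: lessThan_Suc_atMost)
  qed (use F True in auto)
next
  case False
  then show ?thesis
    using words_eq_0 nilspaceD(6)[OF V w] nilspaceD(6)[OF V v] subspace_0[OF N] by simp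
qed

section \<open>The dimension bound and the case of equality\<close>

lemma partner:
  assumes "nondeg W" "x \<in> W" "x \<noteq> 0"
  obtains x' where "x' \<in> W" "b x x' = 1"
proof -
  obtain y where y: "y \<in> W" "b x y \<noteq> 0" using assms by (auto simp: nondeg_def)
  show ?thesis
    using y assms(1) that[of "scale (inverse (b x y)) y"]
    by (simp add: b_simps nondeg_def subspace_scale)
qed

lemma nonzero_vector:
  assumes "dim W \<noteq> 0"
  obtains x where "x \<in> W" "x \<noteq> 0"
  using assms by (metis dim_eq_0 singleton_iff subsetI)

text \<open>In \<open>dim_reduction\<close> the reduced maps contribute at most
  \<open>\<nu>\<^sup>2\<close> and the other two terms at most \<open>2 * \<nu> + 2\<close>;
  subtracting 1 gives the next square.\<close>

lemma nilspace_dim_le: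
  assumes two: "(2::'a) \<noteq> 0"
  shows "nilspace W V \<Longrightarrow> dim W = 2 * \<nu> \<Longrightarrow> fn.dim V \<le> \<nu>\<^sup>2"
proof (induct \<nu> arbitrary: W V)
  case 0
  then have "W \<subseteq> {0}" by simp
  have "V \<subseteq> fn.span {}"
  proof
    fix u assume "u \<in> V"
    then have "u = 0" using nilspaceD(8)[OF 0(1)] \<open>W \<subseteq> {0}\<close> by (auto simp: fun_eq_iff)
    then show "u \<in> fn.span {}" by simp
  qed
  then show ?case using fn.dim_le_card[of V "{}"] by simp
next
  case (Suc \<nu>)
  note V = Suc(2)
  obtain x where x: "x \<in> W" "x \<noteq> 0" using nonzero_vector[of W] Suc(3) by auto
  obtain x' where x': "x' \<in> W" "b x x' = 1" using partner[OF nilspaceD(1)[OF V] x] by blast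
  have "fn.dim (reduced_maps V x x') \<le> \<nu>\<^sup>2"
    using Suc(3) dim_reduced_space[OF V x x'] by (intro Suc(1)[OF nilspace_reduced_maps[OF V x x']]) simp
  moreover have "dim (tensor_partners W V x) \<le> dim (orth W (orbit_span V x))"
    by (intro dim_subset tensor_partners_subset[OF V x two])
  moreover have "dim (orth W (orbit_span V x)) + dim (orbit_span V x) = dim W"
    by (intro dim_orth nilspaceD[OF V] subspace_orbit_span[OF V x] orbit_span_subset[OF V x])
  ultimately show ?case
    using dim_reduction[OF V x x' two] Suc(3) by (simp add: power2_eq_square)
qed

text \<open>Equality in \<open>nilspace_dim_le\<close> forces equality in both estimates of its
  inductive step.\<close>

lemma nilspace_dim_eq:
  assumes two: "(2::'a) \<noteq> 0" and V: "nilspace W V" and x: "x \<in> W" "x \<noteq> 0"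
    and x': "x' \<in> W" "b x x' = 1" and d: "dim W = 2 * Suc \<nu>" "fn.dim V = (Suc \<nu>)\<^sup>2"
  shows "fn.dim (reduced_maps V x x') = \<nu>\<^sup>2" "tensor_partners W V x = orth W (orbit_span V x)"
proof -
  have 1: "fn.dim (reduced_maps V x x') \<le> \<nu>\<^sup>2"
    using d(1) dim_reduced_space[OF V x x'] by (intro nilspace_dim_le[OF two nilspace_reduced_maps[OF V x x']]) simp
  have 2: "dim (tensor_partners W V x) \<le> dim (orth W (orbit_span V x))"
    by (intro dim_subset tensor_partners_subset[OF V x two])
  have 3: "dim (orth W (orbit_span V x)) + dim (orbit_span V x) = dim W"
    by (intro dim_orth nilspaceD[OF V] subspace_orbit_span[OF V x] orbit_span_subset[OF V x])
  note 4 = dim_reduction[OF V x x' two]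
  have e: "(Suc \<nu>)\<^sup>2 = \<nu>\<^sup>2 + 2 * \<nu> + 1" by (simp add: power2_eq_square)
  have "fn.dim V = \<nu>\<^sup>2 + 2 * \<nu> + 1" "dim W = 2 * \<nu> + 2" using d e by simp_all
  then have "\<nu>\<^sup>2 \<le> fn.dim (reduced_maps V x x')" "dim (orth W (orbit_span V x)) \<le> dim (tensor_partners W V x)"
    using 1 2 3 4 by linarith+
  then show "fn.dim (reduced_maps V x x') = \<nu>\<^sup>2" using 1 by simp
  show "tensor_partners W V x = orth W (orbit_span V x)"
    using \<open>dim (orth W (orbit_span V x)) \<le> dim (tensor_partners W V x)\<close>
    by (intro subspace_dim_equal subspace_tensor_partners[OF V x] subspace_orth
        nilspaceD(2)[OF V] tensor_partners_subset[OF V x two])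
qed

section \<open>The common kernel\<close>

text \<open>The vector \<open>x\<close> is taken in the range of \<open>u ^^ (p - 1)\<close>, where \<open>p\<close> is the largest
  nilpotency index in \<open>V\<close> and is attained by \<open>u\<close>: the linear coefficient of \<open>(u + s v) ^^ p = 0\<close>
  gives \<open>u ^^ (p - 1) \<circ> v \<circ> u ^^ (p - 1) = 0\<close>.\<close>

lemma exists_isotropic:
  assumes V: "nilspace W V" and F: "infinite (UNIV :: 'a set) \<or> dim W \<le> card (UNIV :: 'a set)"
    and W: "dim W \<noteq> 0"
  shows "\<exists>x\<in>W. x \<noteq> 0 \<and> (\<forall>v\<in>V. b x (v x) = 0)"
proof -
  have Wu: "(u ^^ i) z \<in> W" if "u \<in> V" "z \<in> W" for u i z
    using that nilspaceD(8)[OF V] by (cases i) auto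
  let ?P = "\<lambda>p. \<forall>u\<in>V. \<forall>z\<in>W. (u ^^ p) z = 0"
  define p where "p = (LEAST p. ?P p)"
  have P: "?P (dim W)"
    using nilpotent_on_subspace[OF nilspaceD(6)[OF V] nilspaceD(7)[OF V] nilspaceD(2)[OF V] Wu order_refl]
    by blast
  have p: "?P p" "p \<le> dim W" unfolding p_def using P by (rule LeastI, rule Least_le)
  have "p \<noteq> 0"
  proof
    assume "p = 0"
    then have "W \<subseteq> {0}" using p fn.subspace_0[OF nilspaceD(3)[OF V]] by auto
    then show False using W by simp
  qed
  then obtain q where q: "p = Suc q" using not0_implies_Suc by blast
  then have "\<not> ?P q" using not_less_Least[of q ?P] by (simp add: p_def)
  then obtain u z where u: "u \<in> V" "z \<in> W" "(u ^^ q) z \<noteq> 0" by blast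
  have "b ((u ^^ q) z) (v ((u ^^ q) z)) = 0" if v: "v \<in> V" for v
  proof -
    note l = nilspaceD(6)[OF V u(1)] nilspaceD(6)[OF V v]
    have vp: "(v ^^ p) z = 0" using p(1) v u(2) by blast
    have "words u v p 1 z = 0"
    proof (cases "q = 0")
      case True
      then show ?thesis using words_diag[OF l, of p z] vp by (simp add: q)
    next
      case False
      \<comment> \<open>The coefficient of \<open>s ^ p\<close> is \<open>(v ^^ p) z = 0\<close>.
        Dropping it leaves \<open>p\<close> coefficients, so a field with \<open>dim W\<close>
        elements suffices. For \<open>p = 1\<close> the linear coefficient is itself that top
        one.\<close>
      have "words u v p 1 z \<in> {0}"
      proof (rule polynomial_coeffs_in_subspace[of p])
        fix s
        have "((\<lambda>z. u z + scale s (v z)) ^^ p) z = 0"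
          using p(1) nilspace_comb[OF V u(1) v] u(2) by blast
        then show "(\<Sum>i<p. scale (s ^ i) (words u v p i z)) \<in> {0}"
          using words_expand[OF l, of p s z] words_diag[OF l, of p z] vp
          by (simp add: lessThan_Suc_atMost[symmetric])
      qed (use F p(2) False q in auto)
      then show ?thesis by simp
    qed
    then have "u (words u v q 1 z) + v ((u ^^ q) z) = 0" by (simp add: q words_0)
    \<comment> \<open>The first summand dies because \<open>u ^^ p\<close> vanishes on
      \<open>W\<close>; in the second, \<open>u ^^ q\<close> is moved across \<open>b\<close> up to
      a sign.\<close>
    then have "(u ^^ q) (u (words u v q 1 z) + v ((u ^^ q) z)) = 0"
      using linD(3)[OF linear_funpow[OF l(1)]] by simp
    then have "(u ^^ p) (words u v q 1 z) + (u ^^ q) (v ((u ^^ q) z)) = 0"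
      using linD(1)[OF linear_funpow[OF l(1)]] by (simp add: q funpow_swap1)
    moreover have "words u v q 1 z \<in> W"
      using nilspaceD(8)[OF V] u(1,2) v by (intro words_mem nilspaceD(2)[OF V]) auto
    ultimately have "(u ^^ q) (v ((u ^^ q) z)) = 0" using p(1) u(1) by simp
    then show ?thesis
      using symmetric_endos_funpow[OF nilspaceD(5)[OF V u(1)]] by (simp add: b_simps)
  qed
  then show ?thesis using u Wu by (intro bexI[of _ "(u ^^ q) z"]) auto
qed

text \<open>If some coefficient did not vanish, then for suitable \<open>\<mu>\<close> and \<open>s\<close> the vector
  \<open>\<Sum>j. \<mu>\<^sup>j v\<^sup>j x\<close> would be an eigenvector of \<open>v + s C\<close> for \<open>1 / \<mu>\<close>.\<close>

lemma rank_one_perturbation: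
  assumes V: "nilspace W V" and F: "infinite (UNIV :: 'a set) \<or> dim W \<le> card (UNIV :: 'a set)"
    and x: "x \<in> W" "x \<noteq> 0" and v: "v \<in> V" and C: "C \<in> V"
    and c: "\<And>j. C ((v ^^ j) x) = scale (c j) x" "c 0 = 0"
  shows "c j = 0"
proof -
  let ?n = "dim W"
  note lv = linD[OF nilspaceD(6)[OF V v]] and lC = linD[OF nilspaceD(6)[OF V C]]
  have Wv: "(v ^^ i) x \<in> W" for i
    using nilspaceD(8)[OF V v] x(1) by (cases i) auto
  have v0: "(v ^^ j) x = 0" if "?n \<le> j" for j
    by (rule nilpotent_on_subspace[OF nilspaceD(6,7)[OF V v] nilspaceD(2)[OF V] Wv that])
  have h: "(\<Sum>j<?n. \<mu> ^ j * c j) = 0" for \<mu>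
  proof (rule ccontr)
    assume nz: "(\<Sum>j<?n. \<mu> ^ j * c j) \<noteq> 0" (is "?h \<noteq> 0")
    have "\<mu> \<noteq> 0"
    proof
      assume "\<mu> = 0"
      then have "(\<Sum>j<?n. \<mu> ^ j * c j) = 0" using c(2) by (intro sum.neutral) (auto simp: power_0_left)
      then show False using nz by simp
    qed
    \<comment> \<open>The finite geometric series for the inverse of \<open>1 - \<mu> v\<close>,
      applied to \<open>x\<close>.\<close>
    define z where "z = (\<Sum>j<?n. scale (\<mu> ^ j) ((v ^^ j) x))"
    have Cz: "C z = scale ?h x"
      by (simp add: z_def lC c(1) scale_sum_left)
    have "scale \<mu> (v z) = (\<Sum>j<?n. scale (\<mu> ^ Suc j) ((v ^^ Suc j) x))"
      by (simp add: z_def lv scale_sum_right)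
    also have "x + \<dots> = (\<Sum>j<Suc ?n. scale (\<mu> ^ j) ((v ^^ j) x))"
      by (subst sum.lessThan_Suc_shift) simp
    also have "\<dots> = z" using v0[of ?n] by (simp add: z_def)
    finally have *: "x + scale \<mu> (v z) = z" .
    \<comment> \<open>The factor turns \<open>C z\<close>, which is \<open>?h\<close> times
      \<open>x\<close>, into the missing term \<open>x / \<mu>\<close>.\<close>
    have "v z + scale (inverse (\<mu> * ?h)) (C z) = scale (inverse \<mu>) (x + scale \<mu> (v z))"
      using nz \<open>\<mu> \<noteq> 0\<close> by (simp add: Cz scale_right_distrib field_simps)
    then have "v z + scale (inverse (\<mu> * ?h)) (C z) = scale (inverse \<mu>) z" by (simp only: *)
    moreover have "z \<noteq> 0" using Cz nz x(2) lC(3) by auto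
    ultimately show False
      using nilspace_no_eigenvalue[OF V nilspace_comb[OF V v C]] \<open>\<mu> \<noteq> 0\<close> by (metis nonzero_imp_inverse_nonzero)
  qed
  show ?thesis
  proof (cases "j < ?n")
    case True
    then show ?thesis by (rule vanishing_polynomial_coeffs[OF F h])
  next
    case False
    then show ?thesis using c(1)[of j] v0[of j] lC(3) x(2) by simp
  qed
qed

text \<open>By double orthogonality it suffices to test against \<open>y\<close> orthogonal to
  \<open>orbit_span V x\<close>, for which \<open>sym_tensor x y\<close> lies in \<open>V\<close>.
  The case \<open>y = x\<close> comes first: it makes \<open>sym_tensor x y\<close> map the iterates
  of \<open>x\<close> into the line of \<open>x\<close>, as \<open>rank_one_perturbation\<close>
  requires.\<close>

lemma powers_in_orbit_span:
  assumes two: "(2::'a) \<noteq> 0" and V: "nilspace W V"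
    and F: "infinite (UNIV :: 'a set) \<or> dim W \<le> card (UNIV :: 'a set)"
    and x: "x \<in> W" "x \<noteq> 0" and iso: "\<And>v. v \<in> V \<Longrightarrow> b x (v x) = 0"
    and eq: "tensor_partners W V x = orth W (orbit_span V x)" and v: "v \<in> V"
  shows "(v ^^ k) x \<in> orbit_span V x"
proof (rule orth_orth[OF nilspaceD(1)[OF V] subspace_orbit_span[OF V x] orbit_span_subset[OF V x]])
  show "(v ^^ k) x \<in> W" using nilspaceD(8)[OF V v] x(1) by (cases k) auto
  have "x \<in> orth W (orbit_span V x)"
    using x iso by (auto simp: orth_def orbit_span_iff[OF V x] b_simps alternating)
  then have "sym_tensor x x \<in> V" using eq by (auto simp: tensor_partners_def[OF V x])
  have xv: "b x ((v ^^ j) x) = 0" for j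
  proof -
    have "2 * b x ((v ^^ j) x) = 0"
      by (rule rank_one_perturbation[OF V F x v \<open>sym_tensor x x \<in> V\<close>, where c="\<lambda>j. 2 * b x ((v ^^ j) x)"])
        (simp_all add: sym_tensor_def alternating scale_left_distrib[symmetric])
    then show ?thesis using two by simp
  qed
  fix y assume y: "y \<in> orth W (orbit_span V x)"
  then have "sym_tensor x y \<in> V" using eq by (auto simp: tensor_partners_def[OF V x])
  moreover have "b y x = 0" using y orbit_span_base(1)[OF V x] by (auto simp: orth_def)
  ultimately show "b y ((v ^^ k) x) = 0"
    using rank_one_perturbation[OF V F x v, of "sym_tensor x y" "\<lambda>j. b y ((v ^^ j) x)"]
    by (simp add: sym_tensor_def xv)
qed

text \<open>As \<open>w x = 0\<close>, the only surviving word with one letter \<open>v\<close>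
  applies \<open>v\<close> first.\<close>

lemma words_1_kernel:
  assumes "lin w" "lin v" "w x = 0"
  shows "words w v (Suc r) 1 x = (w ^^ r) (v x)"
proof (induct r)
  case (Suc r)
  have "(w ^^ Suc r) x = 0" using assms(3) linD(3)[OF linear_funpow[OF assms(1)]] by (simp add: funpow_swap1)
  then show ?case using Suc linD(3)[OF assms(2)] by (simp add: words_0)
qed (simp add: linD(3)[OF assms(1)])

text \<open>As \<open>w (w z) = 0\<close>, the letter \<open>v\<close> must act first or
  second.\<close>

lemma words_1_kernel_square:
  assumes "lin w" "lin v" "w (w z) = 0"
  shows "words w v (Suc (Suc r)) 1 z = (w ^^ Suc r) (v z) + (w ^^ r) (v (w z))"
proof (induct r)
  case (Suc r)
  have "(w ^^ Suc (Suc r)) z = 0"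
    using assms(3) linD(3)[OF linear_funpow[OF assms(1)]] by (simp add: funpow_swap1)
  moreover have "words w v (Suc (Suc (Suc r))) 1 z = w (words w v (Suc (Suc r)) 1 z) + v ((w ^^ Suc (Suc r)) z)"
    by (simp add: words_0)
  ultimately show ?case using Suc linD(1)[OF assms(1)] linD(3)[OF assms(2)] by simp
qed (simp add: linD(3)[OF assms(1)])

lemma line_stable:
  assumes "lin w" "w x = 0" "z \<in> span {x}"
  shows "w z = 0"
  using assms(2,3) linD(5)[OF assms(1)] by (auto simp: span_singleton)

section \<open>Regular nilpotent elements lifted from the reduced space\<close>

lemma regular_fixator:
  assumes V: "nilspace W V" and x: "x \<in> W" "x \<noteq> 0" and x': "x' \<in> W" "b x x' = 1"
    and reg: "\<exists>w\<in>reduced_maps V x x'. \<exists>z\<in>reduced_space W x x'. (w ^^ m) z \<noteq> 0"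
  obtains w e where "w \<in> V" "w x = 0" "e \<in> W" "b x e = 0" "(w ^^ m) e \<notin> span {x}"
proof -
  obtain w' z where w': "w' \<in> reduced_maps V x x'" "z \<in> reduced_space W x x'" "(w' ^^ m) z \<noteq> 0" using reg by blast
  obtain w where w: "w \<in> fixator V x" "w' = pr x x' \<circ> w \<circ> pr x x'"
    using w'(1) by (auto simp: reduced_maps_def[OF V x x'])
  have z: "z \<in> W" "b x z = 0" using w'(2) by (auto simp: reduced_space_def[OF V x x'])
  have "(w' ^^ m) z = pr x x' ((w ^^ m) z)"
    using compress_funpow[OF V x x' w(1) z(2)] pr_id[OF V x x' w'(2)] w(2) by simp
  then have "(w ^^ m) z \<notin> span {x}"
    using w'(3) line_stable[OF pr_lin[OF V x x'] pr_simps(3)[OF V x x']] by auto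
  then show ?thesis using that[of w z] w(1) z by (auto simp: fixator_def[OF V x])
qed

text \<open>The complement of \<open>x\<close> modulo \<open>x\<close> has dimension
  \<open>m + 1\<close>, which bounds strings there. A string of full length makes \<open>w\<close> a
  single Jordan block, whose kernel is a line.\<close>

lemma regular_fixator_kernel:
  assumes V: "nilspace W V" and x: "x \<in> W" "x \<noteq> 0" and w: "w \<in> V" "w x = 0" and m: "dim W = m + 3"
  shows "\<And>z k. z \<in> W \<Longrightarrow> b x z = 0 \<Longrightarrow> (w ^^ k) z \<notin> span {x} \<Longrightarrow> k \<le> m"
    and "\<And>e z. e \<in> W \<Longrightarrow> b x e = 0 \<Longrightarrow> (w ^^ m) e \<notin> span {x} \<Longrightarrow>
      z \<in> W \<Longrightarrow> b x z = 0 \<Longrightarrow> w z \<in> span {x} \<Longrightarrow> \<exists>c. z - scale c ((w ^^ m) e) \<in> span {x}"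
proof -
  let ?S = "orth W (span {x})" and ?K = "span {x}"
  note lw = nilspaceD(6)[OF V w(1)]
  have S: "z \<in> ?S \<longleftrightarrow> z \<in> W \<and> b x z = 0" for z
    using b_swap[of x z] by (auto simp: orth_def span_singleton b_simps)
  have sS: "subspace ?S" using nilspaceD(2)[OF V] by (rule subspace_orth)
  have "dim ?K = 1" using x(2) by simp
  then have dS: "dim ?S = m + 2"
    using dim_orth[OF nilspaceD(1)[OF V], of ?K] m span_minimal[of "{x}" W] x(1) nilspaceD(2)[OF V] by simp
  have K: "subspace ?K" "\<And>z. z \<in> ?K \<Longrightarrow> w z \<in> ?K"
    using line_stable[OF lw w(2)] by (auto simp: span_zero)
  have KS: "?K \<subseteq> ?S"
    using sS S x(1) by (intro span_minimal) (auto simp: alternating)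
  have wS: "w z \<in> ?S" if "z \<in> ?S" for z
  proof -
    have "w \<in> fixator V x" using w by (simp add: fixator_def[OF V x])
    then show ?thesis using S nilspaceD(8)[OF V w(1)] fixator_perp[OF V x] by simp
  qed
  then have wSp: "(w ^^ i) z \<in> ?S" if "z \<in> ?S" for i z using that by (induct i) auto
  obtain M where M: "\<And>z. (w ^^ M) z = 0" using nilspaceD(7)[OF V w(1)] by (auto simp: nilpotent_def)
  show le: "k \<le> m" if z: "z \<in> W" "b x z = 0" and k: "(w ^^ k) z \<notin> ?K" for z k
  proof -
    have "\<exists>k. (w ^^ k) z \<notin> ?K \<and> (\<forall>i. (w ^^ i) z \<notin> ?K \<longrightarrow> i \<le> k)"
    proof (rule Nat.ex_has_greatest_nat[of "\<lambda>i. (w ^^ i) z \<notin> ?K", OF k])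
      show "\<forall>y. (w ^^ y) z \<notin> ?K \<longrightarrow> y \<le> M"
      proof (intro allI impI)
        fix y assume "(w ^^ y) z \<notin> ?K"
        then show "y \<le> M"
          using M funpow_funpow[of M w "y - M" z] span_zero by (cases "y \<le> M") auto
      qed
    qed
    then obtain k' where k': "(w ^^ k') z \<notin> ?K" "\<And>i. (w ^^ i) z \<notin> ?K \<Longrightarrow> i \<le> k'" by blast
    have "dim ?K + (k' + 1) \<le> dim ?S"
      by (rule string_in_subspace(1)[OF lw K k'(1) _ sS KS wSp]) (use k'(2) z S in \<open>auto dest: leD\<close>)
    then show ?thesis using k'(2)[OF k] dS \<open>dim ?K = 1\<close> by simp
  qed
  show "\<exists>c. z - scale c ((w ^^ m) e) \<in> ?K"
    if e: "e \<in> W" "b x e = 0" "(w ^^ m) e \<notin> ?K" and z: "z \<in> W" "b x z = 0" "w z \<in> ?K" for e z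
  proof -
    have ee: "(w ^^ i) e \<in> ?K" if "i > m" for i using le[OF e(1,2), of i] that by force
    have "span (?K \<union> (\<lambda>i. (w ^^ i) e) ` {..m}) = ?S"
      by (rule string_in_subspace(2)[OF lw K e(3) ee sS KS wSp]) (use e S dS \<open>dim ?K = 1\<close> in auto)
    then show ?thesis using string_kernel[OF lw K e(3) ee _ z(3)] z S by simp
  qed
qed

text \<open>The words in \<open>w\<close> and \<open>v\<close> with two letters \<open>v\<close> yield \<open>v (w\<^sup>i (v x)) \<in> orbit_span V x\<close>, and for generic
  \<open>v\<close> the vectors \<open>w\<^sup>i (v x)\<close> span \<open>orbit_span V x\<close> modulo \<open>x\<close>.\<close>

lemma orbit_span_stable:
  assumes V: "nilspace W V" and F: "infinite (UNIV :: 'a set) \<or> k + 2 < card (UNIV :: 'a set)"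
    and x: "x \<in> W" "x \<noteq> 0" and pw: "\<And>v j. v \<in> V \<Longrightarrow> (v ^^ j) x \<in> orbit_span V x"
    and iso: "\<And>v. v \<in> V \<Longrightarrow> b x (v x) = 0" and w: "w \<in> V" "w x = 0"
    and ker: "\<And>z. z \<in> W \<Longrightarrow> b x z = 0 \<Longrightarrow> w z \<in> span {x} \<Longrightarrow> \<exists>c. z - scale c y \<in> span {x}"
    and v0: "v0 \<in> V" "(w ^^ k) (v0 x) \<notin> span {x}"
    and k: "\<And>v j. v \<in> V \<Longrightarrow> j > k \<Longrightarrow> (w ^^ j) (v x) \<in> span {x}"
  shows "orbit_span V x = span (insert x ((\<lambda>i. (w ^^ i) (v0 x)) ` {..k}))"
    and "\<And>v z. v \<in> V \<Longrightarrow> z \<in> orbit_span V x \<Longrightarrow> v z \<in> orbit_span V x"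
proof -
  let ?N = "orbit_span V x" and ?K = "span {x}"
  let ?Sp = "\<lambda>v. span (insert x ((\<lambda>i. (w ^^ i) (v x)) ` {..k}))"
  note lw = nilspaceD(6)[OF V w(1)] and sN = subspace_orbit_span[OF V x]
  have FF: "infinite (UNIV :: 'a set) \<or> r < card (UNIV :: 'a set)" if "r \<le> k + 2" for r
    using F that by auto
  have NW: "z \<in> W" "b x z = 0" if "z \<in> ?N" for z
  proof -
    show "z \<in> W" using that orbit_span_subset[OF V x] by blast
    show "b x z = 0" using that iso by (auto simp: orbit_span_iff[OF V x] b_simps alternating)
  qed
  have ws: "w z \<in> ?N" if zN: "z \<in> ?N" for z
  proof -
    obtain a u where u: "u \<in> V" "z = scale a x + u x" using zN by (auto simp: orbit_span_iff[OF V x])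
    have "words w u (Suc 1) 1 x \<in> ?N"
      by (rule words_in_subspace[OF V FF sN w(1) u(1) pw]) auto
    then show ?thesis
      using words_1_kernel[OF lw nilspaceD(6)[OF V u(1)] w(2), of 1] u(2) w(2) by (simp add: linD[OF lw])
  qed
  have wsp: "(w ^^ i) z \<in> ?N" if "z \<in> ?N" for z i using that ws by (induct i) auto
  have wx: "(w ^^ Suc j) x = 0" for j
    using w(2) linD(3)[OF linear_funpow[OF lw]] by (simp add: funpow_swap1)
  have top: "(w ^^ Suc k) z \<in> ?K" if zN: "z \<in> ?N" for z
  proof -
    obtain a u where u: "u \<in> V" "z = scale a x + u x" using zN by (auto simp: orbit_span_iff[OF V x])
    then have "(w ^^ Suc k) z = (w ^^ Suc k) (u x)"
      using linD(1,5)[OF linear_funpow[OF lw, of "Suc k"]] wx[of k] by simp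
    then show ?thesis using k[OF u(1), of "Suc k"] by simp
  qed
  \<comment> \<open>Modulo \<open>x\<close>, both \<open>(w ^^ i) z\<close> and
    \<open>(w ^^ k) (v x)\<close> lie in the line of \<open>y\<close> once \<open>w\<close> sends
    them into the line of \<open>x\<close>. Subtracting a multiple of
    \<open>(w ^^ (k - i)) (v x)\<close> from \<open>z\<close> therefore lowers the exponent.\<close>
  have desc: "z \<in> ?Sp v" if v: "v \<in> V" "(w ^^ k) (v x) \<notin> ?K"
    and "i \<le> Suc k" "z \<in> ?N" "(w ^^ i) z \<in> ?K" for v i z
    using that(3-)
  proof (induct i arbitrary: z)
    case 0
    then show ?case using span_mono[of "{x}" "insert x ((\<lambda>i. (w ^^ i) (v x)) ` {..k})"] by auto
  next
    case (Suc i)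
    let ?t = "(w ^^ i) z" and ?y0 = "(w ^^ k) (v x)"
    have vx: "v x \<in> ?N" using orbit_span_base(2)[OF V x v(1)] .
    obtain c where c: "?t - scale c y \<in> ?K"
      using ker[OF NW[OF wsp[OF Suc(3)]]] Suc(4) by auto
    obtain c0 where c0: "?y0 - scale c0 y \<in> ?K"
      using ker[OF NW[OF wsp[OF vx]], of k] k[OF v(1), of "Suc k"] by auto
    have "c0 \<noteq> 0" using c0 v(2) by auto
    have "(?t - scale c y) - scale (c / c0) (?y0 - scale c0 y) \<in> ?K"
      by (rule span_diff[OF c span_scale[OF c0]])
    moreover have "(?t - scale c y) - scale (c / c0) (?y0 - scale c0 y) = ?t - scale (c / c0) ?y0"
      using \<open>c0 \<noteq> 0\<close> by (simp add: scale_right_diff_distrib)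
    moreover define z' where "z' = z - scale (c / c0) ((w ^^ (k - i)) (v x))"
    have "(w ^^ i) z' = ?t - scale (c / c0) ?y0"
      using Suc(2) linD(2,5)[OF linear_funpow[OF lw, of i]] by (simp add: z'_def funpow_funpow)
    ultimately have "(w ^^ i) z' \<in> ?K" by simp
    moreover have "z' \<in> ?N"
      unfolding z'_def using Suc(3) wsp[OF vx] sN by (intro subspace_diff subspace_scale)
    ultimately have "z' \<in> ?Sp v" using Suc(1,2) by simp
    moreover have "(w ^^ (k - i)) (v x) \<in> ?Sp v" by (intro span_base) auto
    ultimately have "z' + scale (c / c0) ((w ^^ (k - i)) (v x)) \<in> ?Sp v"
      by (intro span_add span_scale)
    then show ?case by (simp add: z'_def)
  qed
  have sub: "?N \<subseteq> ?Sp v" if "v \<in> V" "(w ^^ k) (v x) \<notin> ?K" for v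
    using desc[OF that order_refl] top by blast
  have "?Sp v0 \<subseteq> ?N"
    using orbit_span_base[OF V x] v0(1) wsp sN by (intro span_minimal) auto
  then show "?N = ?Sp v0" using sub[OF v0] by blast
  have st: "v z \<in> ?N" if v: "v \<in> V" "(w ^^ k) (v x) \<notin> ?K" and z: "z \<in> ?N" for v z
  proof -
    interpret v: Vector_Spaces.linear scale scale v by (rule nilspaceD(6)[OF V v(1)])
    have "v ((w ^^ i) (v x)) \<in> ?N" if i: "i \<le> k" for i
    proof -
      \<comment> \<open>This unfolds the coefficient \<open>words w v (Suc (Suc i)) 2 x\<close>,
        with its word in a single \<open>v\<close> given by \<open>words_1_kernel\<close>. Stability
        of \<open>?N\<close> under \<open>w\<close> removes the first summand.\<close>
      have "w (words w v (Suc i) 2 x) + v ((w ^^ i) (v x)) \<in> ?N"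
        using words_in_subspace[OF V FF sN w(1) v(1) pw, of "Suc (Suc i)" 2] i
          words_1_kernel[OF lw nilspaceD(6)[OF V v(1)] w(2), of i]
        by (simp add: numeral_2_eq_2)
      moreover have "words w v (Suc i) 2 x \<in> ?N"
        by (rule words_in_subspace[OF V FF sN w(1) v(1) pw]) (use i in auto)
      ultimately have "w (words w v (Suc i) 2 x) + v ((w ^^ i) (v x)) - w (words w v (Suc i) 2 x) \<in> ?N"
        using sN ws by (intro subspace_diff)
      then show ?thesis by simp
    qed
    then have "?Sp v \<subseteq> {z. v z \<in> ?N}"
      using orbit_span_base(2)[OF V x v(1)] by (intro span_minimal v.subspace_linear_preimage[OF sN]) auto
    then show ?thesis using sub[OF v] z by blast
  qed
  show "v z \<in> ?N" if v: "v \<in> V" and z: "z \<in> ?N" for v z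
  proof (cases "(w ^^ k) (v x) \<in> ?K")
    case False
    then show ?thesis using st v z by blast
  next
    case True
    \<comment> \<open>If \<open>v\<close> is not generic, then \<open>v + v0\<close> is, and
      \<open>v\<close> is a difference of two generic maps.\<close>
    let ?u = "\<lambda>z. v z + scale 1 (v0 z)"
    have u: "?u \<in> V" by (rule nilspace_comb[OF V v v0(1)])
    have "(w ^^ k) (?u x) \<notin> ?K"
    proof
      assume "(w ^^ k) (?u x) \<in> ?K"
      then have "(w ^^ k) (v x) + (w ^^ k) (v0 x) \<in> ?K" using linD(1)[OF linear_funpow[OF lw, of k]] by simp
      then show False using True v0(2) span_add_eq by blast
    qed
    then have "?u z - v0 z \<in> ?N" using st u v0 z sN by (intro subspace_diff) blast+
    then show ?thesis by simp
  qed
qed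

text \<open>The hypothesis \<open>reg\<close> provides regular elements one step lower; it lets
  \<open>regular_element\<close> call this lemma inside its own induction.\<close>

lemma kernel_vector:
  assumes two: "(2::'a) \<noteq> 0" and V: "nilspace W V" and d: "dim W = 2 * Suc \<nu>" "fn.dim V = (Suc \<nu>)\<^sup>2"
    and F: "infinite (UNIV :: 'a set) \<or> dim W \<le> card (UNIV :: 'a set)"
    and reg: "\<And>W V. nilspace W V \<Longrightarrow> dim W = 2 * \<nu> \<Longrightarrow> fn.dim V = \<nu>\<^sup>2 \<Longrightarrow> \<nu> \<noteq> 0 \<Longrightarrow>
      \<exists>w\<in>V. \<exists>z\<in>W. (w ^^ (2 * \<nu> - 1)) z \<noteq> 0"
  shows "\<exists>x\<in>W. x \<noteq> 0 \<and> (\<forall>u\<in>V. u x = 0)"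
proof (rule ccontr)
  assume no: "\<not> ?thesis"
  let ?P = "\<lambda>x. x \<in> W \<and> x \<noteq> 0 \<and> (\<forall>v\<in>V. b x (v x) = 0)"
  define x where "x = (ARG_MIN (\<lambda>x. dim (orbit_span V x)) x. ?P x)"
  have "\<exists>x. ?P x" using exists_isotropic[OF V F] d(1) by auto
  then have Px: "?P x" and min: "\<And>y. ?P y \<Longrightarrow> dim (orbit_span V x) \<le> dim (orbit_span V y)"
    unfolding x_def using arg_min_nat_lemma[of ?P _ "\<lambda>x. dim (orbit_span V x)"] by blast+
  let ?N = "orbit_span V x" and ?K = "span {x}"
  have x: "x \<in> W" "x \<noteq> 0" and iso: "\<And>v. v \<in> V \<Longrightarrow> b x (v x) = 0" using Px by auto
  obtain x' where x': "x' \<in> W" "b x x' = 1" using partner[OF nilspaceD(1)[OF V] x] by blast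
  have notK: "u x \<notin> ?K" if "u \<in> V" "u x \<noteq> 0" for u
    using nilspace_no_eigenvalue[OF V that(1) x(2)] that(2) by (auto simp: span_singleton)
  obtain u0 where u0: "u0 \<in> V" "u0 x \<noteq> 0" using no x by blast
  have tensor_partners: "tensor_partners W V x = orth W ?N" by (rule nilspace_dim_eq(2)[OF two V x x' d])
  \<comment> \<open>In dimension 2, a nonzero \<open>V x\<close> would make \<open>?N\<close> all of
    \<open>W\<close>, although \<open>x\<close> is orthogonal to \<open>?N\<close>.\<close>
  have "\<nu> \<noteq> 0"
  proof
    assume "\<nu> = 0"
    have "\<not> (\<lambda>u. u x) ` V \<subseteq> {0}" using u0 by auto
    then have "0 < dim ((\<lambda>u. u x) ` V)" unfolding neq0_conv[symmetric] by (simp only: dim_eq_0 not_False_eq_True)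
    moreover have "x \<in> orth W ?N"
      using x iso by (auto simp: orth_def orbit_span_iff[OF V x] b_simps alternating)
    then have "0 < dim (orth W ?N)" unfolding neq0_conv[symmetric] using x(2) by auto
    moreover have "dim W = 2" using d(1) \<open>\<nu> = 0\<close> by simp
    ultimately show False
      using dim_orth[OF nilspaceD(1)[OF V] subspace_orbit_span[OF V x] orbit_span_subset[OF V x]]
        dim_orbit_span[OF V x] by linarith
  qed
  define m where "m = 2 * \<nu> - 1"
  have dm: "dim W = m + 3" using d(1) \<open>\<nu> \<noteq> 0\<close> by (simp add: m_def)
  have "\<exists>w\<in>reduced_maps V x x'. \<exists>z\<in>reduced_space W x x'. (w ^^ m) z \<noteq> 0"
    unfolding m_def
    using dim_reduced_space[OF V x x'] d(1) \<open>\<nu> \<noteq> 0\<close> nilspace_dim_eq(1)[OF two V x x' d]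
    by (intro reg nilspace_reduced_maps[OF V x x']) auto
  then obtain w e where w: "w \<in> V" "w x = 0" and e: "e \<in> W" "b x e = 0" "(w ^^ m) e \<notin> ?K"
    using regular_fixator[OF V x x'] by metis
  note lw = nilspaceD(6)[OF V w(1)]
  have perp: "u x \<in> W" "b x (u x) = 0" if "u \<in> V" for u using that iso nilspaceD(8)[OF V] by auto
  note km = regular_fixator_kernel(1)[OF V x w dm]
  have "\<exists>k. (\<exists>v\<in>V. (w ^^ k) (v x) \<notin> ?K) \<and> (\<forall>j. (\<exists>v\<in>V. (w ^^ j) (v x) \<notin> ?K) \<longrightarrow> j \<le> k)"
  proof (rule Nat.ex_has_greatest_nat[of "\<lambda>k. \<exists>v\<in>V. (w ^^ k) (v x) \<notin> ?K"])
    show "\<exists>v\<in>V. (w ^^ 0) (v x) \<notin> ?K" using notK[OF u0] u0 by auto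
    show "\<forall>k. (\<exists>v\<in>V. (w ^^ k) (v x) \<notin> ?K) \<longrightarrow> k \<le> m" using km perp by blast
  qed
  then obtain k v0 where v0: "v0 \<in> V" "(w ^^ k) (v0 x) \<notin> ?K"
    and k: "\<And>v j. v \<in> V \<Longrightarrow> j > k \<Longrightarrow> (w ^^ j) (v x) \<in> ?K" by (meson not_le)
  have "k \<le> m" using km perp v0 by blast
  \<comment> \<open>Here \<open>k + 2 \<le> m + 2 < dim W\<close>, as needed for polynomials of
    degree \<open>k + 2\<close>.\<close>
  then have F2: "infinite (UNIV :: 'a set) \<or> k + 2 < card (UNIV :: 'a set)" using F dm by auto
  have pw: "(v ^^ j) x \<in> orbit_span V x" if "v \<in> V" for v j
    by (rule powers_in_orbit_span[OF two V F x _ tensor_partners that]) (rule iso)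
  have ker: "\<exists>c. z - scale c ((w ^^ m) e) \<in> ?K" if "z \<in> W" "b x z = 0" "w z \<in> ?K" for z
    by (rule regular_fixator_kernel(2)[OF V x w dm e that])
  have N: "?N = span (insert x ((\<lambda>i. (w ^^ i) (v0 x)) ` {..k}))"
    by (rule orbit_span_stable(1)[where y="(w ^^ m) e", OF V F2 x _ _ w _ v0]) (fact pw | fact iso | fact ker | fact k)+
  have st: "v z \<in> ?N" if "v \<in> V" "z \<in> ?N" for v z
    by (rule orbit_span_stable(2)[where y="(w ^^ m) e", OF V F2 x _ _ w _ v0 _ that])
      (fact pw | fact iso | fact ker | fact k)+
  then have stp: "(v ^^ i) z \<in> ?N" if "v \<in> V" "z \<in> ?N" for v i z using that by (induct i) auto
  have sing: "b z t = 0" if z: "z \<in> ?N" and t: "t \<in> ?N" for z t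
  proof -
    have zx: "b x z = 0" if "z \<in> ?N" for z
      using that iso by (auto simp: orbit_span_iff[OF V x] b_simps alternating)
    obtain a v where v: "v \<in> V" "t = scale a x + v x" using t by (auto simp: orbit_span_iff[OF V x])
    \<comment> \<open>By stability \<open>v z\<close> remains in \<open>?N\<close>, all of which is
      orthogonal to \<open>x\<close>.\<close>
    have "b z (v x) = b x (v z)" by (rule symmetric_endosD(2)[OF nilspaceD(5)[OF V v(1)]])
    then have "b z (v x) = 0" using zx[OF st[OF v(1) z]] by simp
    then show ?thesis using v zx[OF z] b_swap[of z x] by (simp add: b_simps)
  qed
  define y where "y = (w ^^ k) (v0 x)"
  have yN: "y \<in> ?N" unfolding y_def by (intro stp w orbit_span_base(2)[OF V x] v0)
  have y: "y \<in> W" "y \<noteq> 0" using yN orbit_span_subset[OF V x] v0(2) span_zero by (auto simp: y_def)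
  have "?P y" using y sing[OF yN st[OF _ yN]] by blast
  have "orbit_span V y \<subseteq> ?N"
    unfolding orbit_span_def[of V y] using yN st by (intro span_minimal subspace_orbit_span[OF V x]) auto
  then have Ny: "orbit_span V y = ?N"
    using min[OF \<open>?P y\<close>] by (intro subspace_dim_equal subspace_orbit_span[OF V x] subspace_orbit_span[OF V y])
  have dN: "dim ?N \<le> k + 2"
  proof -
    have "dim ?N \<le> card (insert x ((\<lambda>i. (w ^^ i) (v0 x)) ` {..k}))"
      by (rule dim_le_card) (simp_all add: N)
    also have "\<dots> \<le> Suc (card ((\<lambda>i. (w ^^ i) (v0 x)) ` {..k}))" by (rule card_insert_le_m1) auto
    also have "\<dots> \<le> Suc (card {..k})" using card_image_le[of "{..k}"] by simp
    finally show ?thesis by simp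
  qed
  have nil: "(u ^^ (k + 2)) z = 0" if "u \<in> V" "z \<in> ?N" for u z
    by (rule nilpotent_on_subspace[OF nilspaceD(6,7)[OF V that(1)] subspace_orbit_span[OF V x] stp[OF that] dN])
  \<comment> \<open>The linear coefficient of \<open>(w + s v) ^^ (k + 2)\<close>, a power that
    vanishes on \<open>?N\<close> because \<open>dim ?N \<le> k + 2\<close>.\<close>
  have wd: "words w v (Suc (Suc k)) 1 z = 0" if "v \<in> V" "z \<in> ?N" for v z
    using words_in_subspace[OF V F2 subspace_single_0 w(1) that(1), of z 1] nil[OF _ that(2)] by simp
  have "(w ^^ Suc k) (v0 x) = 0"
    using wd[OF v0(1) orbit_span_base(1)[OF V x]] words_1_kernel[OF lw nilspaceD(6)[OF V v0(1)] w(2), of "Suc k"]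
    by simp
  then have wy: "w y = 0" by (simp add: y_def)
  show False
  proof (cases k)
    case 0
    \<comment> \<open>Now \<open>?N\<close> is spanned by \<open>x\<close> and
      \<open>y = v0 x\<close>. All squares vanish on \<open>?N\<close>; those of \<open>v\<close>
      and \<open>v + v0\<close> at \<open>y\<close> give \<open>v0 (v y) = 0\<close>, where
      \<open>v y\<close> is \<open>x\<close> up to a multiple of \<open>y\<close>.\<close>
    have v0y: "v0 y = 0" using nil[OF v0(1) orbit_span_base(1)[OF V x]] 0 by (simp add: y_def numeral_2_eq_2)
    have "x \<in> orbit_span V y" using Ny orbit_span_base(1)[OF V x] by simp
    then obtain a v where v: "v \<in> V" "x = scale a y + v y" by (auto simp: orbit_span_iff[OF V y])
    let ?s = "\<lambda>z. v z + scale 1 (v0 z)"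
    have "?s (?s y) = 0"
      using nil[OF nilspace_comb[OF V v(1) v0(1), of 1] yN] 0 by (simp add: numeral_2_eq_2)
    moreover have "v (v y) = 0" using nil[OF v(1) yN] 0 by (simp add: numeral_2_eq_2)
    ultimately have "v0 (v y) = 0"
      using v0y linD(1,3)[OF nilspaceD(6)[OF V v(1)]] linD(1,3)[OF nilspaceD(6)[OF V v0(1)]] by simp
    moreover have "v y = x - scale a y" using v(2) by (simp add: algebra_simps)
    ultimately have "v0 x = 0" using v0y linD(2,5)[OF nilspaceD(6)[OF V v0(1)]] by simp
    then show False using y(2) 0 by (simp add: y_def)
  next
    case (Suc k')
    \<comment> \<open>The aim is a \<open>v\<close> with \<open>(w ^^ k) (v y) = y\<close>. With
      \<open>w z = y\<close>, the linear coefficient at \<open>z\<close> is then \<open>y\<close>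
      instead of 0.\<close>
    have "v0 x \<in> orbit_span V y" using Ny orbit_span_base(2)[OF V x v0(1)] by simp
    then obtain a v where v: "v \<in> V" "v0 x = scale a y + v y" by (auto simp: orbit_span_iff[OF V y])
    have wky: "(w ^^ k) y = 0" using wy linD(3)[OF linear_funpow[OF lw]] by (simp add: Suc funpow_swap1)
    have "y = (w ^^ k) (scale a y + v y)" using v(2) by (simp add: y_def)
    also have "\<dots> = (w ^^ k) (v y)" using wky linD(1,5)[OF linear_funpow[OF lw, of k]] by simp
    finally have "(w ^^ k) (v y) = y" by simp
    define z where "z = (w ^^ k') (v0 x)"
    have wz: "w z = y" by (simp add: z_def y_def Suc)
    have zN: "z \<in> ?N" unfolding z_def by (intro stp w orbit_span_base(2)[OF V x] v0)
    interpret wk: Vector_Spaces.linear scale scale "w ^^ Suc k" by (rule linear_funpow[OF lw])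
    have "(w ^^ Suc k) ((w ^^ i) (v0 x)) = 0" for i
    proof -
      have "(w ^^ Suc k) ((w ^^ i) (v0 x)) = (w ^^ i) (w y)"
        by (simp only: y_def funpow_funpow funpow.simps o_apply flip: funpow_Suc_right)
          (simp only: funpow_funpow funpow_swap1 add.commute)
      then show ?thesis using wy linD(3)[OF linear_funpow[OF lw]] by simp
    qed
    moreover have "(w ^^ Suc k) x = 0"
      using w(2) linD(3)[OF linear_funpow[OF lw, of k]] by (simp add: funpow_swap1)
    ultimately have "?N \<subseteq> {t. (w ^^ Suc k) t = 0}"
      unfolding N by (intro span_minimal wk.subspace_kernel) auto
    then have "(w ^^ Suc k) (v z) = 0" using st[OF v(1) zN] by blast
    then have "words w v (Suc (Suc k)) 1 z = y"
      using words_1_kernel_square[OF lw nilspaceD(6)[OF V v(1)], of z k] wz wy \<open>(w ^^ k) (v y) = y\<close> by simp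
    then show False using wd[OF v(1) zN] y(2) by simp
  qed
qed

lemma orbit_span_kernel:
  assumes V: "nilspace W V" and Vx: "\<forall>u\<in>V. u x = 0"
  shows "orbit_span V x = span {x}"
proof -
  have "(\<lambda>u. u x) ` V = {0}"
    using Vx fn.subspace_0[OF nilspaceD(3)[OF V]] by (auto intro!: image_eqI[of _ _ 0])
  then show ?thesis by (simp add: orbit_span_def insert_commute[of x 0])
qed

text \<open>An element that is regular modulo \<open>x\<close> is adjusted so that its longest
  string in the complement of \<open>x\<close> continues to a nonzero multiple of \<open>x\<close>;
  the string of \<open>x'\<close> then has length \<open>dim W\<close>.\<close>

lemma regular_element_step:
  assumes two: "(2::'a) \<noteq> 0" and V: "nilspace W V" and d: "dim W = 2 * Suc \<nu>" "fn.dim V = (Suc \<nu>)\<^sup>2"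
    and reg: "\<And>W V. nilspace W V \<Longrightarrow> dim W = 2 * \<nu> \<Longrightarrow> fn.dim V = \<nu>\<^sup>2 \<Longrightarrow> \<nu> \<noteq> 0 \<Longrightarrow>
      \<exists>w\<in>V. \<exists>z\<in>W. (w ^^ (2 * \<nu> - 1)) z \<noteq> 0"
    and x: "x \<in> W" "x \<noteq> 0" and Vx: "\<And>u. u \<in> V \<Longrightarrow> u x = 0"
  shows "\<exists>w\<in>V. \<exists>z\<in>W. (w ^^ (2 * Suc \<nu> - 1)) z \<noteq> 0"
proof -
  let ?K = "span {x}"
  obtain x' where x': "x' \<in> W" "b x x' = 1" using partner[OF nilspaceD(1)[OF V] x] by blast
  have cK: "orbit_span V x = ?K" by (rule orbit_span_kernel[OF V]) (use Vx in blast)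
  have tensor_partners: "tensor_partners W V x = orth W ?K"
    using nilspace_dim_eq(2)[OF two V x x' d] cK by simp
  have tpV: "sym_tensor x y \<in> V" if "y \<in> orth W ?K" for y
    using that tensor_partners by (auto simp: tensor_partners_def[OF V x])
  show ?thesis
  proof (cases "\<nu> = 0")
    case True
    have "x \<in> orth W ?K" using x by (auto simp: orth_def span_singleton b_simps alternating)
    moreover have "sym_tensor x x x' \<noteq> 0"
      using x' x(2) two by (simp add: sym_tensor_def scale_left_distrib[symmetric])
    ultimately show ?thesis using tpV x'(1) True by (intro bexI[of _ "sym_tensor x x"] bexI[of _ x']) auto
  next
    case False
    define m where "m = 2 * \<nu> - 1"
    have dm: "dim W = m + 3" and m2: "2 * Suc \<nu> - 1 = m + 2" using d(1) False by (auto simp: m_def)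
    have "\<exists>w\<in>reduced_maps V x x'. \<exists>z\<in>reduced_space W x x'. (w ^^ m) z \<noteq> 0"
      unfolding m_def
      using dim_reduced_space[OF V x x'] d(1) False nilspace_dim_eq(1)[OF two V x x' d]
      by (intro reg nilspace_reduced_maps[OF V x x']) auto
    then obtain w e where w: "w \<in> V" "w x = 0" and e: "e \<in> W" "b x e = 0" "(w ^^ m) e \<notin> ?K"
      using regular_fixator[OF V x x'] by metis
    have perp: "(u ^^ i) z \<in> W \<and> b x ((u ^^ i) z) = 0" if "u \<in> V" "z \<in> W" "b x z = 0" for u i z
    proof -
      have "u \<in> fixator V x" using that(1) Vx by (simp add: fixator_def[OF V x])
      then show ?thesis using that nilspaceD(8)[OF V that(1)] fixator_perp[OF V x] by (cases i) auto
    qed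
    have "\<exists>w\<in>V. (w ^^ m) e \<notin> ?K \<and> (w ^^ Suc m) e \<noteq> 0"
    proof (cases "(w ^^ Suc m) e = 0")
      case True
      have "\<exists>y\<in>orth W ?K. b y ((w ^^ m) e) \<noteq> 0"
        using orth_orth[OF nilspaceD(1)[OF V], of ?K "(w ^^ m) e"] e perp[OF w(1) e(1,2)]
          span_minimal[of "{x}" W] x(1) nilspaceD(2)[OF V] by auto
      \<comment> \<open>Adding \<open>sym_tensor x y\<close> changes \<open>w\<close> on the
        complement of \<open>x\<close> only by multiples of \<open>x\<close>. Regularity modulo
        \<open>x\<close> survives, and \<open>e\<close> is now sent by the next power to
        \<open>b y ((w ^^ m) e)\<close> times \<open>x\<close>.\<close>
      then obtain y where y: "y \<in> orth W ?K" "b y ((w ^^ m) e) \<noteq> 0" by blast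
      have "b y x = 0" using y(1) span_base[of x "{x}"] by (auto simp: orth_def)
      let ?u = "\<lambda>z. w z + scale 1 (sym_tensor x y z)"
      have u: "?u \<in> V" by (rule nilspace_comb[OF V w(1) tpV[OF y(1)]])
      have uKt: "?u (z + scale c x) = w z + scale (b y z) x" if "b x z = 0" for z c
        using that w(2) linD[OF nilspaceD(6)[OF V w(1)]] \<open>b y x = 0\<close>
        by (simp add: sym_tensor_def b_simps alternating)
      have "\<exists>c. (?u ^^ j) e = (w ^^ j) e + scale c x" for j
      proof (induct j)
        case 0
        show ?case by (rule exI[of _ 0]) simp
      next
        case (Suc j)
        then show ?case using uKt perp[OF w(1) e(1,2), of j] by auto
      qed
      then obtain c where c: "(?u ^^ m) e = (w ^^ m) e + scale c x" by blast
      have "(?u ^^ Suc m) e = scale (b y ((w ^^ m) e)) x"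
        using c uKt perp[OF w(1) e(1,2), of m] True by simp
      then have "(?u ^^ Suc m) e \<noteq> 0" using x(2) y(2) by simp
      moreover have "(?u ^^ m) e \<notin> ?K"
        using e(3) c span_add_eq2[of "scale c x" "{x}" "(w ^^ m) e"] span_scale[OF span_base[of x "{x}"], of c]
        by simp
      ultimately show ?thesis using u by blast
    qed (use w e in blast)
    then obtain w where w: "w \<in> V" "(w ^^ m) e \<notin> ?K" "(w ^^ Suc m) e \<noteq> 0" by blast
    note lw = nilspaceD(6)[OF V w(1)]
    note ker = regular_fixator_kernel[OF V x w(1) Vx[OF w(1)] dm]
    have "(w ^^ Suc m) e \<in> ?K" using ker(1)[OF e(1,2), of "Suc m"] by auto
    then obtain \<alpha> where \<alpha>: "(w ^^ Suc m) e = scale \<alpha> x" by (auto simp: span_singleton)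
    have "\<alpha> \<noteq> 0" using \<alpha> w(3) by auto
    have "(w ^^ (m + 2)) x' \<noteq> 0"
    proof
      assume 0: "(w ^^ (m + 2)) x' = 0"
      have "w \<in> fixator V x" using w(1) Vx by (simp add: fixator_def[OF V x])
      then have t: "w x' \<in> W" "b x (w x') = 0"
        using fixator_perp[OF V x] nilspaceD(8)[OF V w(1)] by auto
      let ?t = "(w ^^ m) (w x')"
      have "w ?t = 0" using 0 by (simp add: funpow_swap1)
      \<comment> \<open>Modulo \<open>x\<close>, \<open>?t\<close> is a multiple of
        \<open>(w ^^ m) e\<close>. As \<open>w\<close> kills \<open>?t\<close> but not that vector,
        \<open>?t\<close> lies in the line of \<open>x\<close> and is orthogonal to
        \<open>e\<close>; symmetry turns this into \<open>b x' ((w ^^ Suc m) e) = 0\<close>.\<close>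
      then obtain c where c: "?t - scale c ((w ^^ m) e) \<in> ?K"
        using ker(2)[OF e(1,2) w(2), of ?t] perp[OF w(1) t] span_zero by auto
      then have "w (?t - scale c ((w ^^ m) e)) = 0"
        using line_stable[OF lw Vx[OF w(1)]] by blast
      then have "scale c (scale \<alpha> x) = 0" using \<open>w ?t = 0\<close> \<alpha> by (simp add: linD[OF lw])
      then have "c = 0" using \<open>\<alpha> \<noteq> 0\<close> x(2) by simp
      then have "?t \<in> ?K" using c by simp
      then have "b ?t e = 0" using e(2) by (auto simp: span_singleton b_simps)
      then have "b (w x') ((w ^^ m) e) = 0"
        using symmetric_endos_funpow[OF nilspaceD(5)[OF V w(1)], of m "w x'" e] by simp
      then have "b x' ((w ^^ Suc m) e) = 0"
        using symmetric_endosD(3)[OF nilspaceD(5)[OF V w(1)], of x' "(w ^^ m) e"] by simp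
      then show False using \<alpha> \<open>\<alpha> \<noteq> 0\<close> x' b_swap[of x' x] by (simp add: b_simps)
    qed
    then show ?thesis using w(1) x'(1) m2 by metis
  qed
qed

lemma regular_element:
  assumes two: "(2::'a) \<noteq> 0" and "nilspace W V" "dim W = 2 * \<nu>" "fn.dim V = \<nu>\<^sup>2" "\<nu> \<noteq> 0"
    and "infinite (UNIV :: 'a set) \<or> 2 * \<nu> \<le> card (UNIV :: 'a set)"
  shows "\<exists>w\<in>V. \<exists>z\<in>W. (w ^^ (2 * \<nu> - 1)) z \<noteq> 0"
  using assms(2-)
proof (induct \<nu> arbitrary: W V)
  case (Suc \<nu>)
  have reg: "\<exists>w\<in>V. \<exists>z\<in>W. (w ^^ (2 * \<nu> - 1)) z \<noteq> 0"
    if "nilspace W V" "dim W = 2 * \<nu>" "fn.dim V = \<nu>\<^sup>2" "\<nu> \<noteq> 0" for W V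
    using Suc(1)[OF that] Suc(6) by auto
  have "infinite (UNIV :: 'a set) \<or> dim W \<le> card (UNIV :: 'a set)" using Suc(3,6) by simp
  then obtain x where x: "x \<in> W" "x \<noteq> 0" "\<forall>u\<in>V. u x = 0"
    using kernel_vector[OF two Suc(2-4) _ reg] by blast
  show ?case by (rule regular_element_step[OF two Suc(2-4) reg x(1,2)]) (use x(3) in blast)+
qed simp

lemma common_kernel:
  assumes two: "(2::'a) \<noteq> 0" and "nilspace W V" "dim W = 2 * Suc \<nu>" "fn.dim V = (Suc \<nu>)\<^sup>2"
    and F: "infinite (UNIV :: 'a set) \<or> dim W \<le> card (UNIV :: 'a set)"
  shows "\<exists>x\<in>W. x \<noteq> 0 \<and> (\<forall>u\<in>V. u x = 0)"
proof (rule kernel_vector[OF assms])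
  show "\<exists>w\<in>V. \<exists>z\<in>W. (w ^^ (2 * \<nu> - 1)) z \<noteq> 0"
    if "nilspace W V" "dim W = 2 * \<nu>" "fn.dim V = \<nu>\<^sup>2" "\<nu> \<noteq> 0" for W V
    by (rule regular_element[OF two that]) (use F assms(3) in auto)
qed

section \<open>Flags\<close>

text \<open>This makes the reduction lemmas, stated for a \<open>nilspace\<close>, available for a
  single map.\<close>

lemma nilspace_span_singleton:
  assumes W: "nondeg W" and u: "u \<in> symmetric_endos" "nilpotent u" "range u \<subseteq> W"
  shows "nilspace W (fn.span {u})"
proof -
  note l = linD[OF symmetric_endosD(1)[OF u(1)]]
  obtain k where k: "\<And>z. (u ^^ k) z = 0" using u(2) by (auto simp: nilpotent_def)
  have "fun_scale scale c u \<in> symmetric_endos \<and> nilpotent (fun_scale scale c u) \<and>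
      range (fun_scale scale c u) \<subseteq> W" for c
  proof (intro conjI)
    have "lin (fun_scale scale c u)" by (rule linI) (simp_all add: fun_scale_def l scale_right_distrib mult.commute)
    then show "fun_scale scale c u \<in> symmetric_endos"
      using symmetric_endosD(2)[OF u(1)] by (simp add: symmetric_endos_def fun_scale_def b_simps)
    have "(fun_scale scale c u ^^ i) z = scale (c ^ i) ((u ^^ i) z)" for i z
      by (induct i) (simp_all add: fun_scale_def l)
    then show "nilpotent (fun_scale scale c u)" using k unfolding nilpotent_def by (metis scale_zero_right)
    show "range (fun_scale scale c u) \<subseteq> W"
      using u(3) W by (auto simp: fun_scale_def nondeg_def intro: subspace_scale)
  qed
  then have "\<forall>v\<in>fn.span {u}. v \<in> symmetric_endos \<and> nilpotent v \<and> range v \<subseteq> W"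
    unfolding fn.span_singleton by blast
  then show ?thesis
    using W unfolding nilspace_def by (intro conjI exI[of _ "{u}"]) auto
qed

text \<open>Splitting off a hyperbolic pair lowers the dimension by 2; the zero space of maps serves
  as the \<open>nilspace\<close> in the reduction lemmas.\<close>

lemma even_dim_nondeg: "nondeg W \<Longrightarrow> even (dim W)"
proof (induct "dim W" arbitrary: W rule: less_induct)
  case less
  show ?case
  proof (cases "dim W = 0")
    case False
    have "0 \<in> symmetric_endos" "nilpotent (0 :: 'b \<Rightarrow> 'b)" "range (0 :: 'b \<Rightarrow> 'b) \<subseteq> W"
      using less(2) linI[of 0]
      by (auto simp: symmetric_endos_def b_simps nondeg_def nilpotent_def subspace_0 intro!: exI[of _ 1])
    then have V: "nilspace W (fn.span {0})" by (rule nilspace_span_singleton[OF less(2)])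
    obtain x where x: "x \<in> W" "x \<noteq> 0" using nonzero_vector[OF False] by blast
    obtain x' where x': "x' \<in> W" "b x x' = 1" using partner[OF less(2) x] by blast
    have "even (dim (reduced_space W x x'))"
      using dim_reduced_space[OF V x x'] by (intro less(1) nondeg_reduced_space[OF V x x']) simp
    then show ?thesis unfolding dim_reduced_space[OF V x x', symmetric] by simp
  next
    case True
    then show ?thesis by (simp only: even_zero)
  qed
qed

lemma dim_totally_singular:
  assumes "totally_singular X"
  shows "2 * dim X \<le> dim (UNIV :: 'b set)"
proof -
  have "subspace X" "X \<subseteq> orth UNIV X" using assms by (auto simp: totally_singular_def orth_def)
  then have "dim X \<le> dim (orth UNIV X)" by (intro dim_subset)
  then show ?thesis using dim_orth[OF nondeg_UNIV \<open>subspace X\<close>] by simp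
qed

lemma witt_index_eq:
  assumes X: "totally_singular X" and d: "dim (UNIV :: 'b set) = 2 * dim X"
  shows "witt_index = dim X"
  unfolding witt_index_def
proof (rule Max_eqI)
  have le: "dim Y \<le> dim X" if "totally_singular Y" for Y
    using dim_totally_singular[OF that] d by simp
  then have "{dim Y |Y. totally_singular Y} \<subseteq> {..dim X}" by auto
  then show "finite {dim Y |Y. totally_singular Y}" by (rule finite_subset) simp
qed (use X dim_totally_singular d in fastforce)+

text \<open>The flag of the reduced space is lifted by adjoining \<open>x\<close>. A nilpotent
  symmetric map stabilising it has the same compression as some element of \<open>V\<close>, and the
  difference is a \<open>sym_tensor x y\<close>, which lies in \<open>V\<close>.\<close>

lemma nilspace_eq_flag_stabilizer:
  assumes two: "(2::'a) \<noteq> 0" and "nilspace W V" "dim W = 2 * \<nu>" "fn.dim V = \<nu>\<^sup>2"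
    and "infinite (UNIV :: 'a set) \<or> 2 * \<nu> \<le> card (UNIV :: 'a set)"
  shows "\<exists>Fl. length Fl = \<nu> + 1 \<and> (\<forall>X\<in>set Fl. subspace X \<and> X \<subseteq> W) \<and> sorted_wrt (\<subseteq>) Fl \<and>
    (\<forall>i<length Fl. dim (Fl ! i) = i) \<and> totally_singular (last Fl) \<and>
    V = {u \<in> symmetric_endos. range u \<subseteq> W \<and> nilpotent u \<and> stabilizes u Fl}"
  using assms(2-)
proof (induct \<nu> arbitrary: W V)
  case 0
  note V = 0(1)
  have "W \<subseteq> {0}" using 0(2) by simp
  then have W: "W = {0}" using subspace_0[OF nilspaceD(2)[OF V]] by blast
  have "u \<in> V" if "range u \<subseteq> W" for u
  proof -
    have "u = 0" using that W by (auto simp: fun_eq_iff)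
    then show ?thesis using fn.subspace_0[OF nilspaceD(3)[OF V]] by simp
  qed
  moreover have "stabilizes u [{0}]" if "u \<in> V" for u
    using linD(3)[OF nilspaceD(6)[OF V that]] by (simp add: stabilizes_def)
  ultimately have "V = {u \<in> symmetric_endos. range u \<subseteq> W \<and> nilpotent u \<and> stabilizes u [{0}]}"
    using V unfolding nilspace_def by blast
  then show ?case
    using W by (intro exI[of _ "[{0}]"]) (simp add: totally_singular_def b_simps)
next
  case (Suc \<nu>)
  note V = Suc(2) and d = Suc(3,4)
  obtain x where x: "x \<in> W" "x \<noteq> 0" and Vx: "\<And>u. u \<in> V \<Longrightarrow> u x = 0"
    using common_kernel[OF two V d] Suc(3,5) by auto
  obtain x' where x': "x' \<in> W" "b x x' = 1" using partner[OF nilspaceD(1)[OF V] x] by blast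
  let ?rW = "reduced_space W x x'" and ?rV = "reduced_maps V x x'" and ?pr = "pr x x'"
  note rV = nilspace_reduced_maps[OF V x x'] and lpr = linD[OF pr_lin[OF V x x']]
  have drW: "dim ?rW = 2 * \<nu>" using dim_reduced_space[OF V x x'] d(1) by simp
  obtain Fl where Fl: "length Fl = \<nu> + 1" "\<And>X. X \<in> set Fl \<Longrightarrow> subspace X"
    "\<And>X. X \<in> set Fl \<Longrightarrow> X \<subseteq> ?rW"
    "sorted_wrt (\<subseteq>) Fl" "\<And>i. i < length Fl \<Longrightarrow> dim (Fl ! i) = i" "totally_singular (last Fl)"
    "?rV = {u \<in> symmetric_endos. range u \<subseteq> ?rW \<and> nilpotent u \<and> stabilizes u Fl}"
    using Suc(1)[OF rV drW nilspace_dim_eq(1)[OF two V x x' d]] Suc(5) by auto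
  let ?E = "\<lambda>X. span (insert x X)"
  \<comment> \<open>Adjoining \<open>x\<close> raises each dimension by 1, so \<open>{0}\<close> is
    prepended.\<close>
  define G where "G = {0} # map ?E Fl"
  have E: "z \<in> ?E X \<longleftrightarrow> (\<exists>c. z - scale c x \<in> X)" if "X \<in> set Fl" for X z
    using Fl(2)[OF that] by (simp add: span_breakdown_eq span_eq_iff[THEN iffD2])
  have Fl_mem: "z \<in> W" "b x z = 0" "b x' z = 0" "?pr z = z" if "X \<in> set Fl" "z \<in> X" for X z
    using Fl(3)[OF that(1)] that(2) pr_id[OF V x x'] by (auto simp: reduced_space_def[OF V x x'])
  have fixr: "u \<in> fixator V x" if "u \<in> V" for u
    using that Vx by (simp add: fixator_def[OF V x])
  have dimE: "dim (?E X) = dim X + 1" if "X \<in> set Fl" for X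
  proof -
    have "x \<notin> X" using Fl_mem(3)[OF that, of x] bx'x[OF V x x'] by auto
    then show ?thesis using Fl(2)[OF that] by (simp add: dim_insert span_eq_iff[THEN iffD2])
  qed
  have ne: "Fl \<noteq> []" using Fl(1) by auto
  have "last Fl \<in> set Fl" using ne by simp
  have 1: "length G = Suc \<nu> + 1" by (simp add: G_def Fl(1))
  have 2: "subspace X \<and> X \<subseteq> W" if X: "X \<in> set G" for X
  proof (cases "X = {0}")
    case True
    then show ?thesis using subspace_0[OF nilspaceD(2)[OF V]] by simp
  next
    case False
    then obtain Y where Y: "Y \<in> set Fl" "X = ?E Y" using X by (auto simp: G_def)
    have "?E Y \<subseteq> W"
      using Fl_mem(1)[OF Y(1)] x(1) by (intro span_minimal nilspaceD(2)[OF V]) auto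
    then show ?thesis using Y(2) by simp
  qed
  have 3: "sorted_wrt (\<subseteq>) G"
  proof -
    have "sorted_wrt (\<lambda>X Y. ?E X \<subseteq> ?E Y) Fl"
      by (rule sorted_wrt_mono_rel[OF _ Fl(4)]) (rule span_mono, blast)
    then show ?thesis by (simp add: G_def sorted_wrt_map span_zero)
  qed
  have 4: "dim (G ! i) = i" if "i < length G" for i
    using that dimE Fl(5) by (cases i) (auto simp: G_def)
  have 5: "totally_singular (last G)"
  proof -
    have l: "last G = ?E (last Fl)" using ne by (simp add: G_def last_map)
    have "b z t = 0" if zt: "z \<in> last G" "t \<in> last G" for z t
    proof -
      obtain c c' where c: "z - scale c x \<in> last Fl" "t - scale c' x \<in> last Fl"
        using zt E[OF \<open>last Fl \<in> set Fl\<close>] l by auto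
      have "b (z - scale c x) (t - scale c' x) = 0" using Fl(6) c by (auto simp: totally_singular_def)
      moreover have "b x (z - scale c x) = 0" "b x (t - scale c' x) = 0"
        using c Fl_mem(2)[OF \<open>last Fl \<in> set Fl\<close>] by blast+
      ultimately show ?thesis using b_swap[of z x] by (simp add: b_simps alternating)
    qed
    then show ?thesis by (simp add: totally_singular_def l)
  qed
  have 6: "u \<in> symmetric_endos \<and> range u \<subseteq> W \<and> nilpotent u \<and> stabilizes u G" if u: "u \<in> V" for u
  proof (intro conjI)
    note lu = linD[OF nilspaceD(6)[OF V u]]
    have "?pr \<circ> u \<circ> ?pr \<in> ?rV" using fixr[OF u] by (auto simp: reduced_maps_def[OF V x x'])
    then have st: "stabilizes (?pr \<circ> u \<circ> ?pr) Fl" using Fl(7) by blast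
    have "u z \<in> ?E X" if X: "X \<in> set Fl" and z: "z \<in> ?E X" for X z
    proof -
      obtain c where c: "z - scale c x \<in> X" using z E[OF X] by blast
      let ?s = "z - scale c x"
      have us: "u z = u ?s" using Vx[OF u] by (simp add: lu)
      have "(?pr \<circ> u \<circ> ?pr) ?s \<in> X" using st X c unfolding stabilizes_def by blast
      then have "?pr (u ?s) \<in> X" using Fl_mem(4)[OF X c] by simp
      moreover have "?pr (u ?s) = u ?s + scale (b x' (u ?s)) x"
        by (rule pr_perp[OF V x x' fixator_perp[OF V x fixr[OF u]]])
      ultimately have "u z - scale (- b x' (u ?s)) x \<in> X" by (simp add: us)
      then show ?thesis using E[OF X] by blast
    qed
    then show "stabilizes u G" using lu(3) by (auto simp: stabilizes_def G_def)
  qed (use nilspaceD(5,7,8)[OF V u] in auto)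
  have 7: "u \<in> V" if u: "u \<in> symmetric_endos" "range u \<subseteq> W" "nilpotent u" "stabilizes u G" for u
  proof -
    have U: "nilspace W (fn.span {u})" by (rule nilspace_span_singleton[OF nilspaceD(1)[OF V] u(1,3,2)])
    have uU: "u \<in> fn.span {u}" by (simp add: fn.span_base)
    have stE: "u z \<in> ?E X" if "X \<in> set Fl" "z \<in> ?E X" for X z
      using u(4) that by (auto simp: stabilizes_def G_def)
    \<comment> \<open>The first lifted member is the line of \<open>x\<close>, and a nilpotent map
      stabilising it kills \<open>x\<close>.\<close>
    have ux: "u x = 0"
    proof -
      have X: "Fl ! 0 \<in> set Fl" using Fl(1) by simp
      have "Fl ! 0 \<subseteq> {0}" using Fl(5)[of 0] Fl(1) dim_eq_0[of "Fl ! 0"] by simp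
      moreover have "u x \<in> ?E (Fl ! 0)" by (rule stE[OF X]) (simp add: span_base)
      ultimately obtain c where "u x - scale c x \<in> {0}" using E[OF X] by blast
      then have "u x = scale c x" by simp
      then show ?thesis using nilspace_no_eigenvalue[OF U uU x(2)] by auto
    qed
    let ?u = "?pr \<circ> u \<circ> ?pr"
    have "?u \<in> reduced_maps (fn.span {u}) x x'"
      using uU ux by (auto simp: reduced_maps_def[OF U x x'] fixator_def[OF U x])
    then have "?u \<in> symmetric_endos" "range ?u \<subseteq> ?rW" "nilpotent ?u"
      using nilspace_reduced_maps[OF U x x'] unfolding nilspace_def by blast+
    moreover have "stabilizes ?u Fl"
      unfolding stabilizes_def
    proof (intro ballI image_subsetI)
      fix X s assume X: "X \<in> set Fl" and s: "s \<in> X"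
      then obtain c where c: "u s - scale c x \<in> X"
        using stE[OF X, of s] E[OF X] span_base[of s "insert x X"] by auto
      have "?u s = ?pr (u s - scale c x)"
        using Fl_mem(4)[OF X s] pr_simps(3)[OF V x x'] by (simp add: lpr)
      then show "?u s \<in> X" using Fl_mem(4)[OF X c] c by simp
    qed
    ultimately have "?u \<in> ?rV" using Fl(7) by blast
    then obtain v where v: "v \<in> V" "?u = ?pr \<circ> v \<circ> ?pr"
      using reduced_maps_def[OF V x x'] fixator_def[OF V x] by auto
    let ?d = "\<lambda>z. u z - v z"
    have "?d \<in> symmetric_endos"
    proof -
      have "lin ?d"
        by (rule linI) (simp_all add: linD[OF symmetric_endosD(1)[OF u(1)]] linD[OF nilspaceD(6)[OF V v(1)]]
            algebra_simps)
      then show ?thesis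
        using symmetric_endosD(2)[OF u(1)] symmetric_endosD(2)[OF nilspaceD(5)[OF V v(1)]]
        by (simp add: symmetric_endos_def b_simps)
    qed
    moreover have "range ?d \<subseteq> W"
      using u(2) nilspaceD(8)[OF V v(1)] subspace_diff[OF nilspaceD(2)[OF V]] by blast
    moreover have "?pr (?d (?pr z)) = 0" for z
      using fun_cong[OF v(2), of z] by (simp add: lpr)
    ultimately obtain y where y: "y \<in> W" "b x y = 0" "?d = sym_tensor x y"
      using compress_kernel[OF V x x' two, of ?d] ux Vx[OF v(1)] by auto
    have cK: "orbit_span V x = span {x}" by (rule orbit_span_kernel[OF V]) (use Vx in blast)
    \<comment> \<open>As \<open>V\<close> kills \<open>x\<close>, its \<open>orbit_span\<close> is
      only the line of \<open>x\<close>, so the equality case applies to every \<open>y\<close> in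
      \<open>W\<close> orthogonal to \<open>x\<close>.\<close>
    have "y \<in> orth W (orbit_span V x)"
      using y b_swap[of y x] cK by (auto simp: orth_def span_singleton b_simps)
    then have "sym_tensor x y \<in> V"
      using nilspace_dim_eq(2)[OF two V x x' d] by (auto simp: tensor_partners_def[OF V x])
    then have "(\<lambda>z. v z + scale 1 (sym_tensor x y z)) \<in> V" by (rule nilspace_comb[OF V v(1)])
    moreover have "(\<lambda>z. v z + scale 1 (sym_tensor x y z)) = u" by (simp add: y(3)[symmetric])
    ultimately show ?thesis by simp
  qed
  have "V = {u \<in> symmetric_endos. range u \<subseteq> W \<and> nilpotent u \<and> stabilizes u G}"
    using 6 7 by blast
  then show ?case using 1 2 3 4 5 by (intro exI[of _ G]) blast
qed

end

lemma two_neq_zero: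
  assumes "CHAR('a::field) \<noteq> 2"
  shows "(2::'a) \<noteq> 0"
proof
  assume "(2::'a) = 0"
  then have "of_nat 2 = (0::'a)" by simp
  then have "CHAR('a) dvd 2" by (simp only: of_nat_eq_0_iff_char_dvd)
  moreover from this have "CHAR('a) \<le> 2" by (rule dvd_imp_le) simp
  then have "CHAR('a) = 0 \<or> CHAR('a) = 1 \<or> CHAR('a) = 2" by linarith
  ultimately have "CHAR('a) = 1 \<or> CHAR('a) = 2" by (elim disjE) simp_all
  then show False using assms CHAR_not_1' by auto
qed

theorem theorem1p6:
  fixes scale :: "'a::field \<Rightarrow> 'b::ab_group_add \<Rightarrow> 'b"
    and Basis :: "'b set"
    and b :: "'b \<Rightarrow> 'b \<Rightarrow> 'a"
    and \<V> :: "('b \<Rightarrow> 'b) set"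
    and n :: nat
    and \<nu> :: real
  assumes "CHAR('a) \<noteq> 2"
    and "symplectic_space scale Basis b"
    and "n = vector_space.dim scale (UNIV :: 'b set)"
    and "module.subspace (fun_scale scale) \<V>"
    and "\<V> \<subseteq> bilinear_space.symmetric_endos scale b"
    and "\<forall>u\<in>\<V>. nilpotent u"
    and "\<nu> = real n / 2"
    and "infinite (UNIV :: 'a set) \<or> card (UNIV :: 'a set) \<ge> n"
    and "real (vector_space.dim (fun_scale scale) \<V>) = \<nu> * (real n - \<nu>)"
  shows "\<exists>F. bilinear_space.maximal_singular_flag scale b F \<and> \<V> = bilinear_space.NS scale b F"
proof -
  interpret symplectic_space scale Basis b by fact
  note n = assms(3)
  obtain k where k: "n = 2 * k" using even_dim_nondeg[OF nondeg_UNIV] n by (auto elim: evenE)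
  have "real (fn.dim \<V>) = real (k\<^sup>2)" using assms(7,9) k by (simp add: power2_eq_square)
  then have dV: "fn.dim \<V> = k\<^sup>2" by (simp only: of_nat_eq_iff)
  \<comment> \<open>\<open>fn.dim\<close> is 0 also without a finite basis, so the dimension yields
    one only for \<open>k \<noteq> 0\<close>; for \<open>k = 0\<close> all maps are zero.\<close>
  have "\<exists>G. finite G \<and> \<V> \<subseteq> fn.span G"
  proof (cases "k = 0")
    case True
    then have "(UNIV :: 'b set) \<subseteq> {0}" using n k dim_eq_0[of UNIV] by simp
    then have "u = 0" for u :: "'b \<Rightarrow> 'b" by (auto simp: fun_eq_iff)
    then have "\<V> \<subseteq> fn.span {}" by auto
    then show ?thesis by blast
  next
    case False
    obtain B where "\<V> \<subseteq> fn.span B" "card B = fn.dim \<V>" using fn.basis_exists[of \<V>] by blast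
    then show ?thesis using dV False by (intro exI[of _ B]) (simp add: card_ge_0_finite)
  qed
  then have V: "nilspace UNIV \<V>"
    using nondeg_UNIV assms(4-6) by (auto simp: nilspace_def)
  obtain Fl where Fl: "length Fl = k + 1" "\<forall>X\<in>set Fl. subspace X" "sorted_wrt (\<subseteq>) Fl"
    "\<forall>i<length Fl. dim (Fl ! i) = i" "totally_singular (last Fl)"
    "\<V> = {u \<in> symmetric_endos. range u \<subseteq> UNIV \<and> nilpotent u \<and> stabilizes u Fl}"
    using nilspace_eq_flag_stabilizer[OF two_neq_zero[OF assms(1)] V _ dV] n k assms(8) by auto
  have "Fl \<noteq> []" using Fl(1) by auto
  then have "dim (last Fl) = k" using Fl(1,4) by (simp add: last_conv_nth)
  then have "witt_index = k" using witt_index_eq[OF Fl(5)] n k by simp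
  then have "maximal_singular_flag Fl"
    using Fl(1-5) \<open>Fl \<noteq> []\<close>
    by (simp add: maximal_singular_flag_def partially_complete_def singular_flag_def flag_def)
  moreover have "\<V> = NS Fl" using Fl(6) by (auto simp: NS_def)
  ultimately show ?thesis by blast
qed

end
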